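(* Let $\lambda$ be a Dyck path and $A(\lambda)$ its tree. For each vertex $v$ of $A(\lambda)$ (including the root) let $e_1,\dots,e_k$ be the edges directly below $v$, let $N_{v,j}$ be the number of edges in the subtree consisting of $e_j$ and all edges below it, and $M_v=\sum_{j=1}^kN_{v,j}$. Then $$\sum_{D\in\mathcal{D}(\lambda/\ast)}q^{\mathrm{art}(D)}=\prod_{v}\genfrac{[}{]}{0pt}{}{M_v}{N_{v,1},\dots,N_{v,k}},$$ the product over all vertices $v$ having at least two edges directly below them (vertices with one child contribute a factor $1$).
   Context: $[n]=\sum_{i=0}^{n-1}q^i$, $[n]!=\prod_{i=1}^n[i]$, $\genfrac{[}{]}{0pt}{}{n}{k_1,\dots,k_r}=[n]!/\prod_i[k_i]!$ for $\sum k_i=n$. Paths: a path of length $L$ is a word in $\{U,D\}$, identified with the lattice path from $(0,0)$ with steps $U=(1,1)$, $D=(1,-1)$; $\lambda(x)$ is its height at $x$. A Dyck path of length $2n$ ends at height $0$ and never goes below $0$. Boxes: for integers $a,b$ with $a+b$ odd, the box centered at $(a,b)$ is the closed square with vertices $(a\pm1,b),(a,b\pm1)$. $Y(\lambda)$ is the set of boxes centered at $(a,b)$ with $b-1\ge\lambda(a)$, $b+1\le a$, $b+1\le 2n-a$. For Dyck paths $\mu$ weakly above $\lambda$, $\lambda/\mu=Y(\lambda)\setminus Y(\mu)$. A Dyck tile is a nonempty set of boxes whose centers listed left to right $c_0,\dots,c_{2k}$ satisfy $c_{i+1}-c_i\in\{(1,\pm1)\}$, none lower than $c_0$, $c_{2k}$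 at the height of $c_0$. A Dyck tiling of $\lambda/\mu$ is a partition into Dyck tiles; cover-inclusive means for every tile $\tau$, $\tau-(0,2)$ either lies entirely below $\lambda$ (each translated box has top vertex at or below $\lambda$) or is contained in a single tile. $\mathrm{art}(D)=(\#\text{boxes}+\#\text{tiles})/2$. $\mathcal{D}(\lambda/\ast)$: all cover-inclusive Dyck tilings of $\lambda/\mu$ over all Dyck paths $\mu$ weakly above $\lambda$. Tree $A(\lambda)$: chords are matched $U$–$D$ pairs (parenthesis matching); $A(\lambda)$ is the rooted plane tree with one edge per chord, the edge of chord $c$ hanging directly below the edge of the innermost chord strictly containing $c$, or from the root if there is none; siblings ordered left to right. *)

theory Defs
  imports "HOL-Computational_Algebra.Polynomial"
begin

definition q_int :: "nat \<Rightarrow> int poly" where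
  "q_int n = (\<Sum>i<n. monom 1 i)"

definition q_fact :: "nat \<Rightarrow> int poly" where
  "q_fact n = (\<Prod>i\<in>{1..n}. q_int i)"

text \<open>q-multinomial [M; N_c (c in C)] = [M]! / prod [N_c]!  (exact division in Z[q]).\<close>
definition q_multinom :: "nat \<Rightarrow> ('c \<Rightarrow> nat) \<Rightarrow> 'c set \<Rightarrow> int poly" where
  "q_multinom M N C = q_fact M div (\<Prod>c\<in>C. q_fact (N c))"

text \<open>A path is a word over {U,D}, encoded as a bool list with True = U, False = D.\<close>

definition ht :: "bool list \<Rightarrow> nat \<Rightarrow> int" where
  "ht w x = sum_list (map (\<lambda>s. if s then 1 else -1) (take x w))"

definition dyck :: "bool list \<Rightarrow> nat \<Rightarrow> bool" where
  "dyck w n \<longleftrightarrow> length w = 2 * n \<and> (\<forall>x\<le>2 * n. 0 \<le> ht w x) \<and> ht w (2 * n) = 0"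

definition weakly_above :: "bool list \<Rightarrow> bool list \<Rightarrow> bool" where
  "weakly_above mu lam \<longleftrightarrow> (\<forall>x\<le>length lam. ht lam x \<le> ht mu x)"

text \<open>A box is identified with its center (a,b), a+b odd.\<close>
type_synonym box = "int \<times> int"

definition Y :: "bool list \<Rightarrow> nat \<Rightarrow> box set" where
  "Y w n = {(a, b). odd (a + b) \<and> 0 \<le> a \<and> a \<le> 2 * int n \<and>
              ht w (nat a) \<le> b - 1 \<and> b + 1 \<le> a \<and> b + 1 \<le> 2 * int n - a}"

definition skew :: "bool list \<Rightarrow> bool list \<Rightarrow> nat \<Rightarrow> box set" where
  "skew lam mu n = Y lam n - Y mu n"

definition dyck_tile :: "box set \<Rightarrow> bool" where
  "dyck_tile T \<longleftrightarrow> (\<exists>cs. cs \<noteq> [] \<and> set cs = T \<and>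
      (\<forall>i. Suc i < length cs \<longrightarrow>
          fst (cs ! Suc i) = fst (cs ! i) + 1 \<and> \<bar>snd (cs ! Suc i) - snd (cs ! i)\<bar> = 1) \<and>
      (\<forall>c\<in>set cs. snd (hd cs) \<le> snd c) \<and>
      snd (last cs) = snd (hd cs))"

definition dyck_tiling :: "bool list \<Rightarrow> bool list \<Rightarrow> nat \<Rightarrow> box set set \<Rightarrow> bool" where
  "dyck_tiling lam mu n D \<longleftrightarrow> (\<forall>T\<in>D. dyck_tile T) \<and> \<Union>D = skew lam mu n \<and>
      (\<forall>T\<in>D. \<forall>T'\<in>D. T \<noteq> T' \<longrightarrow> T \<inter> T' = {})"

text \<open>Cover-inclusive: every tile shifted down by (0,2) either lies entirely below
  lambda (top vertex (a,b-1) of each shifted box at or below lambda) or lies in one tile.\<close>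
definition cover_inclusive :: "bool list \<Rightarrow> box set set \<Rightarrow> bool" where
  "cover_inclusive lam D \<longleftrightarrow> (\<forall>T\<in>D.
      (\<forall>(a, b)\<in>T. b - 1 \<le> ht lam (nat a)) \<or>
      (\<exists>T'\<in>D. (\<lambda>(a, b). (a, b - 2)) ` T \<subseteq> T'))"

definition tilings_star :: "bool list \<Rightarrow> nat \<Rightarrow> (bool list \<times> box set set) set" where
  "tilings_star lam n = {(mu, D). dyck mu n \<and> weakly_above mu lam \<and>
                         dyck_tiling lam mu n D \<and> cover_inclusive lam D}"

text \<open>art(D) = (#boxes + #tiles)/2 (always an integer, as every tile has an odd number of boxes).\<close>
definition art :: "box set set \<Rightarrow> nat" where
  "art D = ((\<Sum>T\<in>D. card T) + card D) div 2"

text \<open>Chords: matched U-D pairs (i,j) of positions (0-indexed) under parenthesis matching.\<close>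
definition chords :: "bool list \<Rightarrow> (nat \<times> nat) set" where
  "chords w = {(i, j). i < j \<and> j < length w \<and> w ! i \<and> \<not> w ! j \<and>
                ht w (Suc j) = ht w i \<and> (\<forall>k. i < k \<and> k \<le> j \<longrightarrow> ht w i < ht w k)}"

definition strictly_contains :: "nat \<times> nat \<Rightarrow> nat \<times> nat \<Rightarrow> bool" where
  "strictly_contains c d \<longleftrightarrow> fst c < fst d \<and> snd d < snd c"

text \<open>Vertices of A(w): None is the root, Some c is the lower endpoint of the edge of chord c.
  Edge c hangs directly below vertex v.\<close>
definition child_of :: "bool list \<Rightarrow> nat \<times> nat \<Rightarrow> (nat \<times> nat) option \<Rightarrow> bool" where
  "child_of w c v \<longleftrightarrow> c \<in> chords w \<and>
     (case v of
        None \<Rightarrow> \<not> (\<exists>d\<in>chords w. strictly_contains d c)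
      | Some d \<Rightarrow> d \<in> chords w \<and> strictly_contains d c \<and>
                  \<not> (\<exists>e\<in>chords w. strictly_contains d e \<and> strictly_contains e c))"

definition vertices :: "bool list \<Rightarrow> (nat \<times> nat) option set" where
  "vertices w = insert None (Some ` chords w)"

definition children :: "bool list \<Rightarrow> (nat \<times> nat) option \<Rightarrow> (nat \<times> nat) set" where
  "children w v = {c. child_of w c v}"

definition subtree_edges :: "bool list \<Rightarrow> nat \<times> nat \<Rightarrow> (nat \<times> nat) set" where
  "subtree_edges w e = {c. (c, e) \<in> {(c', d). child_of w c' (Some d)}\<^sup>*}"

definition N_sub :: "bool list \<Rightarrow> nat \<times> nat \<Rightarrow> nat" where
  "N_sub w e = card (subtree_edges w e)"

definition M_vert :: "bool list \<Rightarrow> (nat \<times> nat) option \<Rightarrow> nat" where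
  "M_vert w v = (\<Sum>e\<in>children w v. N_sub w e)"

end

theory Submission
  imports Defs
begin

text \<open>
  In a cover-inclusive tiling every tile is a piece of \<open>lam\<close> shifted up by \<open>2 k + 1\<close> for some level
  \<open>k \<ge> 0\<close>. The tiling is therefore determined by the number \<open>m x\<close> of boxes above each position \<open>x\<close>
  and the number \<open>j x\<close> of levels at which the boxes above \<open>x\<close> and \<open>x + 1\<close> share a tile. That the
  pieces are Dyck paths means that \<open>j\<close> is a labelling of the chords which weakly decreases towards
  the root; \<open>m\<close> drops by 0 or 1 along up steps, grows by 0 or 1 along down steps, and bounds \<open>j\<close>.
  Then \<open>art\<close> is the sum of \<open>m\<close> minus the sum of the chord labels.

  These configurations are counted by a transfer matrix, indexed by the values of \<open>m\<close> at the two
  ends of a Dyck word and multiplicative under concatenation. For a word with \<open>n\<close> chords it is the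
  product of the vertex factors times a matrix \<open>kernel n\<close> that depends on \<open>n\<close> only (at \<open>q = 1\<close>:
  multiplication by \<open>x\<^sup>n / n!\<close> in the basis of Laguerre polynomials), with corner entry 1.
\<close>

section \<open>Gaussian binomials and the kernel\<close>

text \<open>Neighbouring pieces of a path do not contribute independently: they share the column
  between them, and an enclosing chord bounds every label inside it. A purely numerical product
  formula therefore has no direct induction; the count has to remember the two end columns and a
  floor for the labels. The induction over words U u D v then needs two laws. Enclosing u in a chord
  sums over the label of that chord, a geometric series, and turns \<open>kernel m\<close> into
  \<open>kernel (Suc m)\<close> with no scalar. Placing words side by side multiplies matrices, and
  \<open>kernel m\<close> times \<open>kernel n\<close> is \<open>qbin m n\<close> times
  \<open>kernel (m + n)\<close>, just as x^m/m! times x^n/n! is a binomial coefficient times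
  x^(m+n)/(m+n)!. The tree behaves alike: a new edge above the root creates a vertex with one child,
  of factor 1, while gluing two trees at their roots multiplies the two root factors and a Gaussian
  binomial. For the explicit \<open>kernel\<close>, both laws reduce to recurrences that raise n by
  one.\<close>

definition qv :: "int poly" where
  "qv = monom 1 1"

lemma monom_eq_qv_power: "monom 1 n = qv ^ n"
  by (simp add: qv_def monom_power)

lemma q_int_0 [simp]: "q_int 0 = 0"
  by (simp add: q_int_def)

lemma q_int_add: "q_int (m + n) = q_int m + qv ^ m * q_int n"
  unfolding q_int_def monom_eq_qv_power
  by (induction n) (auto simp: algebra_simps power_add)

lemma q_int_1 [simp]: "q_int (Suc 0) = 1"
  by (simp add: q_int_def monom_eq_qv_power)

lemma q_int_Suc: "q_int (Suc n) = 1 + qv * q_int n"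
  using q_int_add[of 1 n] by simp

text \<open>At \<open>q = 1\<close> the value is n + 1. Nonvanishing is what allows q-integers and
  q-factorials to be cancelled in Z[q], so that identities can be proved after clearing
  denominators.\<close>

lemma q_int_Suc_neq_0: "q_int (Suc n) \<noteq> 0"
proof -
  have "poly (q_int (Suc n)) 1 = 1 + int n"
    by (induction n) (simp_all add: q_int_def poly_monom)
  then show ?thesis by auto
qed

lemma q_fact_0 [simp]: "q_fact 0 = 1"
  by (simp add: q_fact_def)

lemma q_fact_Suc: "q_fact (Suc n) = q_fact n * q_int (Suc n)"
  by (simp add: q_fact_def atLeastAtMostSuc_conv mult.commute)

lemma q_fact_neq_0: "q_fact n \<noteq> 0"
  by (induction n) (simp_all add: q_fact_Suc q_int_Suc_neq_0)

text \<open>\<open>qbin n k\<close> is the Gaussian binomial coefficient with upper index \<open>n + k\<close> and lower index \<open>k\<close>.\<close>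
fun qbin :: "nat \<Rightarrow> nat \<Rightarrow> int poly" where
  "qbin 0 k = 1"
| "qbin (Suc n) 0 = 1"
| "qbin (Suc n) (Suc k) = qbin (Suc n) k + qv ^ Suc k * qbin n (Suc k)"

lemma qbin_0_right [simp]: "qbin n 0 = 1"
  by (cases n) simp_all

text \<open>The q-Pascal step closes because [k+1] + q^(k+1) [n+1] = [n+k+2]. The recursion makes
  \<open>qbin\<close> a polynomial without any division; this is its link to factorials.\<close>

lemma qbin_mult_q_facts: "qbin n k * q_fact n * q_fact k = q_fact (n + k)"
proof (induction n k rule: qbin.induct)
  case (3 n k)
  have "qbin (Suc n) (Suc k) * q_fact (Suc n) * q_fact (Suc k) =
      (qbin (Suc n) k * q_fact (Suc n) * q_fact k) * q_int (Suc k)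
      + qv ^ Suc k * (qbin n (Suc k) * q_fact n * q_fact (Suc k)) * q_int (Suc n)"
    by (simp only: qbin.simps q_fact_Suc algebra_simps)
  also have "\<dots> = q_fact (Suc (n + k)) * (q_int (Suc k) + qv ^ Suc k * q_int (Suc n))"
    using 3 by (simp add: algebra_simps)
  also have "\<dots> = q_fact (Suc n + Suc k)"
    using q_int_add[of "Suc k" "Suc n"] q_fact_Suc[of "Suc (n + k)"] by (simp add: add.commute)
  finally show ?case .
qed simp_all

lemma qbin_Suc_left: "q_int (Suc n) * qbin (Suc n) k = q_int (Suc (n + k)) * qbin n k"
proof -
  have "q_fact n * q_fact k * (q_int (Suc n) * qbin (Suc n) k)
      = q_fact n * q_fact k * (q_int (Suc (n + k)) * qbin n k)"
    using qbin_mult_q_facts[of "Suc n" k] qbin_mult_q_facts[of n k]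
    by (simp add: q_fact_Suc algebra_simps)
  then show ?thesis by (simp add: q_fact_neq_0)
qed

lemma qbin_Suc_right: "q_int (Suc k) * qbin n (Suc k) = q_int (Suc (n + k)) * qbin n k"
proof -
  have "q_fact n * q_fact k * (q_int (Suc k) * qbin n (Suc k))
      = q_fact n * q_fact k * (q_int (Suc (n + k)) * qbin n k)"
    using qbin_mult_q_facts[of n "Suc k"] qbin_mult_q_facts[of n k]
    by (simp add: q_fact_Suc algebra_simps)
  then show ?thesis by (simp add: q_fact_neq_0)
qed

text \<open>Integer exponents make index shifts such as \<open>a - 1\<close> honest subtractions. At
  negative arguments \<open>qp\<close> is 1; in the recurrences such a value meets a coefficient
  that vanishes there.\<close>

definition qp :: "int \<Rightarrow> int poly" where
  "qp i = qv ^ nat i"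

lemma qp_0 [simp]: "qp 0 = 1" by (simp add: qp_def)
lemma qp_1 [simp]: "qp 1 = qv" by (simp add: qp_def)
lemma qp_of_nat [simp]: "qp (int k) = qv ^ k" by (simp add: qp_def)
lemma qp_add: "0 \<le> i \<Longrightarrow> 0 \<le> j \<Longrightarrow> qp (i + j) = qp i * qp j"
  by (simp add: qp_def nat_add_distrib power_add)

text \<open>In closed form, \<open>up n i\<close> and \<open>dn n i\<close> are the coefficients of \<open>z ^ i\<close> in
  \<open>(1 + z) (1 + q z) \<dots> (1 + q\<^sup>n\<^sup>-\<^sup>1 z)\<close> and \<open>(1 + q z) \<dots> (1 + q\<^sup>n z)\<close>.\<close>
primrec up :: "nat \<Rightarrow> int \<Rightarrow> int poly" where
  "up 0 i = (if i = 0 then 1 else 0)"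
| "up (Suc n) i = qp i * up n i + qp (i - 1) * up n (i - 1)"

primrec dn :: "nat \<Rightarrow> int \<Rightarrow> int poly" where
  "dn 0 i = (if i = 0 then 1 else 0)"
| "dn (Suc n) i = qp i * (dn n i + dn n (i - 1))"

lemma up_neg: "i < 0 \<Longrightarrow> up n i = 0"
  by (induction n arbitrary: i) auto

lemma dn_neg: "i < 0 \<Longrightarrow> dn n i = 0"
  by (induction n arbitrary: i) auto

text \<open>Since \<open>up n i\<close> is q^(i(i-1)/2) times the Gaussian binomial of n over i,
  this is the absorption rule for Gaussian binomials; \<open>qv ^ i\<close> is the growth of the
  triangular exponent from i to i + 1.\<close>

lemma up_absorb:
  "q_int (Suc i) * up (Suc n) (1 + int i) = q_int (Suc n) * qv ^ i * up n (int i)"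
proof (induction n arbitrary: i)
  case 0
  show ?case by (cases i) (auto simp: qp_def)
next
  case (Suc n)
  let ?A = "up (Suc n) (int i)"
  have 1: "q_int i * ?A = q_int (Suc n) * qp (int i - 1) * up n (int i - 1)"
    using Suc[of "i - 1"] by (cases i) (simp_all add: up_neg)
  have 2: "q_int (Suc i) * ?A = ?A + qv * (q_int (Suc n) * qp (int i - 1) * up n (int i - 1))"
    unfolding q_int_Suc[of i] distrib_right mult.assoc[of qv] 1 by simp
  have up_suc: "up (Suc (Suc n)) (1 + int i) = qv ^ Suc i * up (Suc n) (1 + int i) + qv ^ i * ?A"
    using qp_add[of 1 "int i"] by (subst up.simps) (simp del: up.simps)
  have "q_int (Suc i) * up (Suc (Suc n)) (1 + int i)
      = qv ^ Suc i * (q_int (Suc i) * up (Suc n) (1 + int i)) + qv ^ i * (q_int (Suc i) * ?A)"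
    by (subst up_suc) (simp add: algebra_simps del: up.simps)
  also have "\<dots> = qv ^ Suc i * (q_int (Suc n) * qv ^ i * up n (int i))
      + qv ^ i * (?A + qv * (q_int (Suc n) * qp (int i - 1) * up n (int i - 1)))"
    by (simp only: Suc 2)
  also have "\<dots> = qv ^ i * ?A + qv ^ Suc i * q_int (Suc n) * ?A"
    by (simp add: algebra_simps)
  also have "\<dots> = q_int (Suc (Suc n)) * qv ^ i * ?A"
    by (subst q_int_Suc[of "Suc n"]) (simp add: algebra_simps)
  finally show ?case .
qed

text \<open>The defining recursion splits the first factor off the product; this one splits off the
  last, 1 + q^(n+1) z.\<close>

lemma dn_Suc_alt: "dn (Suc n) i = dn n i + qv ^ Suc n * dn n (i - 1)"
proof (induction n arbitrary: i)
  case 0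
  show ?case by (auto simp: qp_def)
next
  case (Suc n)
  have a: "dn (Suc (Suc n)) i = qp i * (dn (Suc n) i + dn (Suc n) (i - 1))"
    by simp
  show ?case
  proof (cases "i \<ge> 1")
    case True
    then have qi: "qp i = qv * qp (i - 1)"
      using qp_add[of 1 "i - 1"] by simp
    have "dn (Suc (Suc n)) i = qp i * (dn n i + dn n (i - 1))
        + qv ^ Suc (Suc n) * (qp (i - 1) * (dn n (i - 1) + dn n (i - 1 - 1)))"
      unfolding a Suc qi by (simp add: algebra_simps)
    then show ?thesis by simp
  next
    case False
    then show ?thesis
      by (cases "i = 0") (auto simp: dn_neg)
  qed
qed

text \<open>By the q-binomial theorem, the generating function K_n(x, y) of
  \<open>kernel n a b\<close> over x^a y^b is the product of all 1 + q^i x with 0 \<le> i < n and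
  all 1 + q^i y with 1 \<le> i \<le> n, divided by the product of all 1 - q^i x y with n \<le> i
  \<le> 2n.\<close>

definition kernel :: "nat \<Rightarrow> int \<Rightarrow> int \<Rightarrow> int poly" where
  "kernel n a b = (\<Sum>k\<le>nat a. qv ^ (n * k) * qbin n k * up n (a - int k) * dn n (b - int k))"

text \<open>A common summation range lets kernels at neighbouring rows be combined term by
  term.\<close>

lemma kernel_bound:
  assumes "a < int B"
  shows "kernel n a b = (\<Sum>k<B. qv ^ (n * k) * qbin n k * up n (a - int k) * dn n (b - int k))"
  (is "_ = sum ?f _")
proof (cases "a < 0")
  case True
  then show ?thesis by (simp add: kernel_def up_neg)
next
  case False
  then show ?thesis unfolding kernel_def
    using assms by (intro sum.mono_neutral_left) (auto simp: up_neg)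
qed

lemma kernel_neg: "a < 0 \<or> b < 0 \<Longrightarrow> kernel n a b = 0"
  by (auto simp: kernel_def up_neg dn_neg intro!: sum.neutral)

lemma kernel_0: "kernel 0 a b = (if a = b \<and> 0 \<le> a then 1 else 0)"
proof (cases "0 \<le> a")
  case True
  have "kernel 0 a b = (\<Sum>k\<le>nat a. if k = nat a then (if a = b then 1 else 0) else 0)"
    unfolding kernel_def using True by (intro sum.cong) auto
  then show ?thesis using True by simp
qed (simp add: kernel_neg)

lemma kernel_0_0 [simp]: "kernel n 0 0 = 1"
proof -
  have "up n 0 = 1" "dn n 0 = 1" 
    by (induction n) (simp_all add: up_neg dn_neg)
  then show ?thesis by (simp add: kernel_def)
qed

text \<open>The factor \<open>qv ^ k\<close> replaces the exponents relative to k by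
  \<open>a\<close> and \<open>a - 1\<close>, which no longer depend on k and leave the sum of the
  kernel.\<close>

lemma up_shift:
  "qv ^ k * up (Suc n) (a - int k) = qp a * up n (a - int k) + qp (a - 1) * up n (a - 1 - int k)"
proof -
  have 1: "qv ^ k * (qp (a - int k) * up n (a - int k)) = qp a * up n (a - int k)" for a
  proof (cases "0 \<le> a - int k")
    case True
    then have "qp a = qv ^ k * qp (a - int k)"
      using qp_add[of "int k" "a - int k"] by simp
    then show ?thesis by simp
  qed (simp add: up_neg)
  have "a - int k - 1 = a - 1 - int k" by simp
  then show ?thesis using 1[of a] 1[of "a - 1"] by (simp only: up.simps distrib_left)
qed

lemma dn_shift:
  "qv ^ k * dn (Suc n) (b - int k) = qp b * (dn n (b - int k) + dn n (b - 1 - int k))"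
proof (cases "0 \<le> b - int k")
  case True
  then have "qp b = qv ^ k * qp (b - int k)"
    using qp_add[of "int k" "b - int k"] by simp
  moreover have "b - int k - 1 = b - 1 - int k" by simp
  ultimately show ?thesis by (simp only: dn.simps algebra_simps)
qed (simp add: dn_neg)

text \<open>On generating functions: (1 - q^(n+1) x y) K_(n+1)(x, y) = (1 + x) (1 + q y) K_n(q x, q
  y). The factors 1 + x and 1 + q y will be the two steps of an enclosing chord, and the denominator
  its label.\<close>

lemma kernel_Suc:
  "kernel (Suc n) a b = qv ^ Suc n * kernel (Suc n) (a - 1) (b - 1)
     + qp b * (qp a * (kernel n a b + kernel n a (b - 1))
        + qp (a - 1) * (kernel n (a - 1) b + kernel n (a - 1) (b - 1)))"
proof -
  define B where "B = Suc (nat a)"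
  have B: "a < int B" by (auto simp: B_def)
  define t where "t c k = c * up (Suc n) (a - int k) * dn (Suc n) (b - int k)" for c k
  have "kernel (Suc n) a b = (\<Sum>k<Suc B. t (qv ^ (Suc n * k) * qbin (Suc n) k) k)"
    unfolding t_def using B by (intro kernel_bound) auto
  \<comment> \<open>The q-Pascal rule splits the sum: the part with \<open>k - 1\<close> becomes the
    shifted kernel once k is lowered by one, the other part carries \<open>qbin n k\<close>. The
    spare term k = B pays for the lowering.\<close>
  also have "\<dots> = (\<Sum>k<Suc B. t (qv ^ (Suc n * k) * (if k = 0 then 0 else qbin (Suc n) (k - 1))) k
      + t (qv ^ (Suc n * k) * (qv ^ k * qbin n k)) k)"
  proof (intro sum.cong refl)
    fix k
    have "qbin (Suc n) k = (if k = 0 then 0 else qbin (Suc n) (k - 1)) + qv ^ k * qbin n k"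
      by (cases k) auto
    then show "t (qv ^ (Suc n * k) * qbin (Suc n) k) k
      = t (qv ^ (Suc n * k) * (if k = 0 then 0 else qbin (Suc n) (k - 1))) k
      + t (qv ^ (Suc n * k) * (qv ^ k * qbin n k)) k"
      by (simp add: t_def algebra_simps)
  qed
  also have "\<dots> = (\<Sum>k<Suc B. t (qv ^ (Suc n * k) * (if k = 0 then 0 else qbin (Suc n) (k - 1))) k)
      + (\<Sum>k<Suc B. t (qv ^ (Suc n * k) * (qv ^ k * qbin n k)) k)"
    by (rule sum.distrib)
  also have "(\<Sum>k<Suc B. t (qv ^ (Suc n * k) * (if k = 0 then 0 else qbin (Suc n) (k - 1))) k)
      = (\<Sum>k<B. t (qv ^ (Suc n * Suc k) * qbin (Suc n) k) (Suc k))"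
    by (subst sum.lessThan_Suc_shift) (simp add: t_def)
  also have "\<dots> = qv ^ Suc n * kernel (Suc n) (a - 1) (b - 1)"
  proof -
    have "a - 1 < int B" using B by simp
    then show ?thesis unfolding kernel_bound[OF \<open>a - 1 < int B\<close>] sum_distrib_left
      by (intro sum.cong) (auto simp: t_def algebra_simps power_add simp del: up.simps dn.simps)
  qed
  also have "(\<Sum>k<Suc B. t (qv ^ (Suc n * k) * (qv ^ k * qbin n k)) k)
    = (\<Sum>k<Suc B. qv ^ (n * k) * qbin n k
        * (qv ^ k * up (Suc n) (a - int k)) * (qv ^ k * dn (Suc n) (b - int k)))"
    by (intro sum.cong) (auto simp: t_def algebra_simps power_add simp del: up.simps dn.simps)
  also have "\<dots> = qp b * (qp a * (kernel n a b + kernel n a (b - 1))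
        + qp (a - 1) * (kernel n (a - 1) b + kernel n (a - 1) (b - 1)))"
  proof -
    have "a < int (Suc B)" "a - 1 < int (Suc B)" using B by auto
    note kb = this[THEN kernel_bound]
    show ?thesis
      unfolding up_shift dn_shift kb sum_distrib_left sum.distrib[symmetric]
      by (intro sum.cong) (auto simp: algebra_simps simp del: up.simps dn.simps)
  qed
  finally show ?thesis .
qed

text \<open>At \<open>q = 1\<close>, the three-term recurrence of the Laguerre polynomials: multiplication by \<open>x\<close>.\<close>
definition ladder :: "(int \<Rightarrow> int poly) \<Rightarrow> int \<Rightarrow> int poly" where
  "ladder f a = q_int (nat a) * (qp a * f a + qp (a - 1) * f (a - 1))
     + q_int (nat (a + 1)) * (qp (a + 1) * f (a + 1) + qp a * f a)"

text \<open>Writing [c] = [k] + q^k [c - k] isolates the part to which absorption applies; the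
  recursion of \<open>up\<close> then merges the two absorbed terms into a single multiple of
  [n+1].\<close>

lemma ladder_term:
  assumes "0 \<le> a"
  shows "q_int (nat a) * up (Suc n) (a - int k) + q_int (nat (a + 1)) * up (Suc n) (a + 1 - int k)
    = (qv ^ k * q_int (Suc n) + q_int k) * up (Suc n) (a - int k)
      + q_int k * up (Suc n) (a + 1 - int k)"
proof -
  have split: "q_int (nat c) * up (Suc n) (c - int k)
     = q_int k * up (Suc n) (c - int k) + qv ^ k * (q_int (nat (c - int k)) * up (Suc n) (c - int k))" 
     if "0 \<le> c" for c
  proof (cases "0 \<le> c - int k")
    case True
    then have "nat c = k + nat (c - int k)" by simp
    then show ?thesis using q_int_add[of k "nat (c - int k)"] by (simp only: algebra_simps)
  qed (simp add: up_neg del: up.simps)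
  have absorb: "q_int (nat i) * up (Suc n) i = q_int (Suc n) * (qp (i - 1) * up n (i - 1))" for i
  proof (cases "1 \<le> i")
    case True
    then obtain j where "i = 1 + int j"
      by (metis add.commute diff_add_cancel diff_ge_0_iff_ge zero_le_imp_eq_int)
    moreover have "nat (1 + int j) = Suc j" by simp
    ultimately show ?thesis using up_absorb[of j n] by (simp add: mult.assoc del: up.simps)
  qed (simp add: up_neg del: up.simps)
  let ?i = "a - int k"
  have 3: "q_int (Suc n) * up (Suc n) ?i = q_int (nat ?i) * up (Suc n) ?i + q_int (nat (?i + 1)) * up (Suc n) (?i + 1)"
    unfolding absorb by (simp add: algebra_simps)
  have e: "a + 1 - int k = ?i + 1" by simp
  have "0 \<le> a + 1" using assms by simp
  note 4 = split[OF assms] split[OF this, unfolded e]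
  show ?thesis unfolding e 4 distrib_right mult.assoc[of "qv ^ k" "q_int (Suc n)"] 3
    by (simp only: algebra_simps)
qed

text \<open>The q-form of x * x^n/n! = (n+1) * x^(n+1)/(n+1)!, where multiplication by x acts on the
  row index and the column \<open>b\<close> is a mere parameter.\<close>

lemma ladder_kernel:
  assumes "0 \<le> a"
  shows "ladder (\<lambda>a. kernel n a b) a = q_int (Suc n) * kernel (Suc n) a b"
proof -
  define B where "B = Suc (Suc (nat a))"
  have B: "a + 1 < int B" using assms by (auto simp: B_def)
  define c where "c k = qv ^ (Suc n * k) * qbin n k * dn n (b - int k)" for k
  have g: "qp x * kernel n x b + qp (x - 1) * kernel n (x - 1) b
      = (\<Sum>k<B. c k * up (Suc n) (x - int k))" if "x < int B" for x
  proof -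
    have "x - 1 < int B" using that by simp
    have "(\<Sum>k<B. c k * up (Suc n) (x - int k))
      = (\<Sum>k<B. qv ^ (n * k) * qbin n k * dn n (b - int k) * (qv ^ k * up (Suc n) (x - int k)))"
      by (intro sum.cong) (auto simp: c_def algebra_simps power_add simp del: up.simps dn.simps)
    also have "\<dots> = qp x * kernel n x b + qp (x - 1) * kernel n (x - 1) b"
      unfolding up_shift kernel_bound[OF that] kernel_bound[OF \<open>x - 1 < int B\<close>]
        sum_distrib_left sum.distrib[symmetric]
      by (intro sum.cong) (auto simp: algebra_simps)
    finally show ?thesis by simp
  qed
  have "ladder (\<lambda>a. kernel n a b) a =
     (\<Sum>k<B. c k * (q_int (nat a) * up (Suc n) (a - int k) + q_int (nat (a + 1)) * up (Suc n) (a + 1 - int k)))"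
    using g[of a] g[of "a + 1"] B
    by (simp add: ladder_def sum_distrib_left sum.distrib algebra_simps del: up.simps)
  also have "\<dots> = (\<Sum>k<B. c k * ((qv ^ k * q_int (Suc n) + q_int k) * up (Suc n) (a - int k)))
     + (\<Sum>k<B. c k * (q_int k * up (Suc n) (a + 1 - int k)))"
    unfolding ladder_term[OF assms] distrib_left sum.distrib ..
  \<comment> \<open>The added term k = B is zero because a + 1 < B; it makes room for the index
    shift by one.\<close>
  also have "(\<Sum>k<B. c k * (q_int k * up (Suc n) (a + 1 - int k)))
     = (\<Sum>k<Suc B. c k * (q_int k * up (Suc n) (a + 1 - int k)))"
    using B by (simp add: up_neg del: up.simps)
  also have "\<dots> = (\<Sum>k<B. c (Suc k) * (q_int (Suc k) * up (Suc n) (a - int k)))"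
    by (subst sum.lessThan_Suc_shift) (simp del: up.simps)
  also have "(\<Sum>k<B. c k * ((qv ^ k * q_int (Suc n) + q_int k) * up (Suc n) (a - int k))) + \<dots>
     = (\<Sum>k<B. q_int (Suc n) * (qv ^ (Suc n * k) * qbin (Suc n) k * up (Suc n) (a - int k) * dn (Suc n) (b - int k)))"
    unfolding sum.distrib[symmetric]
  proof (intro sum.cong refl)
    fix k
    have 1: "qv ^ k * q_int (Suc n) + q_int k = q_int (Suc (n + k))"
      using q_int_add[of k "Suc n"] by (simp add: add.commute)
    have 2: "b - int (Suc k) = b - int k - 1" by simp
    \<comment> \<open>The coefficient of \<open>up (Suc n) (a - int k)\<close>: absorption in the
      lower index of \<open>qbin\<close> exposes the last factor of \<open>dn\<close>, and
      absorption in the other index extracts [n+1].\<close>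
    have "c k * (qv ^ k * q_int (Suc n) + q_int k) + c (Suc k) * q_int (Suc k)
      = qv ^ (Suc n * k) * (qbin n k * q_int (Suc (n + k)) * dn n (b - int k)
        + qv ^ Suc n * (q_int (Suc k) * qbin n (Suc k)) * dn n (b - int k - 1))"
      unfolding c_def 1 2 by (simp add: algebra_simps power_add)
    also have "\<dots> = qv ^ (Suc n * k) * (q_int (Suc (n + k)) * qbin n k) * dn (Suc n) (b - int k)"
      unfolding qbin_Suc_right dn_Suc_alt by (simp add: algebra_simps)
    also have "\<dots> = q_int (Suc n) * (qv ^ (Suc n * k) * qbin (Suc n) k * dn (Suc n) (b - int k))"
      unfolding qbin_Suc_left[symmetric] by (simp only: algebra_simps)
    finally have "c k * (qv ^ k * q_int (Suc n) + q_int k) + c (Suc k) * q_int (Suc k) = \<dots>" .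
    note 3 = this
    have "c k * ((qv ^ k * q_int (Suc n) + q_int k) * up (Suc n) (a - int k))
        + c (Suc k) * (q_int (Suc k) * up (Suc n) (a - int k))
      = (c k * (qv ^ k * q_int (Suc n) + q_int k) + c (Suc k) * q_int (Suc k)) * up (Suc n) (a - int k)"
      by (simp only: algebra_simps)
    then show "c k * ((qv ^ k * q_int (Suc n) + q_int k) * up (Suc n) (a - int k))
        + c (Suc k) * (q_int (Suc k) * up (Suc n) (a - int k))
      = q_int (Suc n) * (qv ^ (Suc n * k) * qbin (Suc n) k * up (Suc n) (a - int k) * dn (Suc n) (b - int k))"
      unfolding 3 by (simp only: mult.assoc mult.commute mult.left_commute)
  qed
  also have "\<dots> = q_int (Suc n) * kernel (Suc n) a b"
    using B by (subst kernel_bound[of a B]) (simp_all add: sum_distrib_left del: up.simps dn.simps)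
  finally show ?thesis .
qed

section \<open>Composition law of the kernel\<close>

lemma ladder_sum: "ladder (\<lambda>a. \<Sum>c\<in>I. f a c * g c) a = (\<Sum>c\<in>I. ladder (\<lambda>a. f a c) a * g c)"
  by (simp add: ladder_def sum_distrib_left sum_distrib_right sum.distrib algebra_simps)

text \<open>\<open>ladder\<close> acts on rows only and hence commutes with composition, so [m+1]
  can be traded for one application of it on both sides. Row a of \<open>kernel m\<close> is zero
  beyond column a + m; as \<open>ladder\<close> also reads row a + 1, the bound on \<open>B\<close>
  is arranged to move with m.\<close>

lemma kernel_comp:
  assumes "0 \<le> a" "a + int m \<le> B"
  shows "(\<Sum>c\<in>{0..B}. kernel m a c * kernel n c b) = qbin m n * kernel (m + n) a b"
  using assms
proof (induction m arbitrary: a)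
  case 0
  have "(\<Sum>c\<in>{0..B}. kernel 0 a c * kernel n c b) = (\<Sum>c\<in>{0..B}. if c = a then kernel n a b else 0)"
    using 0 by (intro sum.cong) (auto simp: kernel_0)
  then show ?case using 0 by simp
next
  case (Suc m)
  have "q_int (Suc m) * (\<Sum>c\<in>{0..B}. kernel (Suc m) a c * kernel n c b)
     = (\<Sum>c\<in>{0..B}. ladder (\<lambda>a. kernel m a c) a * kernel n c b)"
    unfolding ladder_kernel[OF Suc.prems(1)] by (simp add: sum_distrib_left mult.assoc)
  also have "\<dots> = ladder (\<lambda>a. \<Sum>c\<in>{0..B}. kernel m a c * kernel n c b) a"
    by (rule ladder_sum[symmetric])
  also have "\<dots> = ladder (\<lambda>a. qbin m n * kernel (m + n) a b) a"
  proof -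
    have "(\<Sum>c\<in>{0..B}. kernel m x c * kernel n c b) = qbin m n * kernel (m + n) x b"
      if "x \<le> a + 1" for x
      using Suc that by (cases "0 \<le> x") (auto simp: kernel_neg)
    then show ?thesis by (simp add: ladder_def)
  qed
  also have "\<dots> = qbin m n * ladder (\<lambda>a. kernel (m + n) a b) a"
    by (simp add: ladder_def algebra_simps)
  also have "\<dots> = q_int (Suc m) * (qbin (Suc m) n * kernel (Suc m + n) a b)"
    unfolding ladder_kernel[OF Suc.prems(1)]
    using qbin_Suc_left[of m n] by (simp add: algebra_simps)
  finally show ?case by (simp add: q_int_Suc_neq_0)
qed

section \<open>Dyck words and chords\<close>

lemma ht_0 [simp]: "ht w 0 = 0"
  by (simp add: ht_def)

lemma ht_Nil [simp]: "ht [] x = 0"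
  by (simp add: ht_def)

lemma ht_Cons_Suc [simp]: "ht (s # w) (Suc x) = (if s then 1 else -1) + ht w x"
  by (simp add: ht_def)

lemma ht_append: "ht (u @ v) x = ht u x + ht v (x - length u)"
  by (simp add: ht_def)

lemma ht_ge_length: "length w \<le> x \<Longrightarrow> ht w x = ht w (length w)"
  by (simp add: ht_def)

lemma ht_Suc: "x < length w \<Longrightarrow> ht w (Suc x) = ht w x + (if w ! x then 1 else -1)"
  by (simp add: ht_def take_Suc_conv_app_nth)

lemma dyck_length: "dyck w n \<Longrightarrow> length w = 2 * n"
  by (simp add: dyck_def)

lemma dyck_ht_end: "dyck w n \<Longrightarrow> ht w (2 * n) = 0"
  by (simp add: dyck_def)

lemma dyck_ht_nonneg: "dyck w n \<Longrightarrow> 0 \<le> ht w x"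
  by (cases "x \<le> 2 * n") (auto simp: dyck_def ht_ge_length[of w x])

lemma dyck_Nil: "dyck [] 0"
  by (simp add: dyck_def)

text \<open>The word U u D v. For Dyck words u and v the displayed D is the first return to height
  0, so every nonempty Dyck word has exactly one such form.\<close>

definition arch :: "bool list \<Rightarrow> bool list \<Rightarrow> bool list" where
  "arch u v = True # u @ False # v"

lemma length_arch [simp]: "length (arch u v) = length u + length v + 2"
  by (simp add: arch_def)

lemma
  assumes "dyck u m"
  shows ht_arch_inner: "x \<le> 2 * m \<Longrightarrow> ht (arch u v) (Suc x) = 1 + ht u x"
    and ht_arch_right: "ht (arch u v) (2 * m + 2 + x) = ht v x"
    and nth_arch_inner: "x < 2 * m \<Longrightarrow> arch u v ! Suc x = u ! x"
    and nth_arch_close: "\<not> arch u v ! Suc (2 * m)"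
    and nth_arch_right: "arch u v ! (2 * m + 2 + x) = v ! x"
  using dyck_length[OF assms] dyck_ht_end[OF assms]
  by (simp_all add: arch_def ht_append ht_ge_length[of u "Suc (2 * m + x)"] Suc_diff_le nth_append)

lemma arch_cases:
  fixes i m :: nat
  obtains "i = 0" | x where "i = Suc x" "x < 2 * m" | "i = Suc (2 * m)" | x where "i = 2 * m + 2 + x"
proof -
  show ?thesis
  proof (cases i)
    case (Suc x)
    then consider "x < 2 * m" | "x = 2 * m" | "x > 2 * m" by linarith
    then show ?thesis
    proof cases
      case 3
      then have "i = 2 * m + 2 + (i - (2 * m + 2))" using Suc by simp
      then show ?thesis using that by blast
    qed (use Suc that in auto)
  qed (use that in auto)
qed

lemma dyck_arch_decomp:
  assumes "dyck w n" "w \<noteq> []"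
  obtains u v m k where "w = arch u v" "dyck u m" "dyck v k" "n = Suc (m + k)"
proof -
  note len = dyck_length[OF assms(1)] and nonneg = dyck_ht_nonneg[OF assms(1)]
  have npos: "n > 0" using assms(2) len by (cases n) auto
  define j where "j = (LEAST j. 0 < j \<and> ht w j = 0)"
  have ex: "0 < 2 * n \<and> ht w (2 * n) = 0" using npos dyck_ht_end[OF assms(1)] by simp
  have j: "0 < j" "ht w j = 0" "j \<le> 2 * n"
    using LeastI[of "\<lambda>j. 0 < j \<and> ht w j = 0", OF ex] Least_le[of "\<lambda>j. 0 < j \<and> ht w j = 0", OF ex]
    unfolding j_def by simp_all
  have before: "0 < ht w x" if "0 < x" "x < j" for x
  proof -
    have "ht w x \<noteq> 0"
      using not_less_Least[of x "\<lambda>j. 0 < j \<and> ht w j = 0"] that unfolding j_def by simp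
    then show ?thesis using nonneg[of x] by simp
  qed
  have w0: "w ! 0" using nonneg[of 1] ht_Suc[of 0 w] npos len by (simp split: if_splits)
  have j2: "j \<ge> 2" using j w0 ht_Suc[of 0 w] npos len by (cases "j = 1") auto
  have wj: "\<not> w ! (j - 1)"
  proof -
    have "0 < ht w (j - 1)" using before[of "j - 1"] j2 by simp
    moreover have "j - 1 < length w" "Suc (j - 1) = j" using j(1,3) len by simp_all
    ultimately
    show ?thesis using ht_Suc[of "j - 1" w] j(2) by (simp split: if_splits)
  qed
  define u where "u = drop 1 (take (j - 1) w)"
  define v where "v = drop j w"
  have w: "w = arch u v"
  proof -
    have "w = take (j - 1) w @ w ! (j - 1) # v"
      using id_take_nth_drop[of "j - 1" w] j j2 len by (simp add: v_def)
    moreover have "take (j - 1) w = True # u"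
    proof -
      have "w = True # tl w" using w0 assms(2) by (cases w) auto
      moreover obtain i where "j = Suc (Suc i)" using j2 by (metis add_2_eq_Suc le_Suc_ex)
      ultimately show ?thesis
        by (metis u_def One_nat_def diff_Suc_1 drop0 drop_Suc_Cons take_Suc_Cons)
    qed
    ultimately show ?thesis using wj unfolding arch_def by simp
  qed
  have lu: "length u = j - 2" unfolding u_def using j len by simp
  have hu: "ht w (Suc x) = 1 + ht u x" if "x \<le> j - 2" for x
    using that lu by (simp add: w arch_def ht_append)
  have hu_end: "ht u (j - 2) = 0"
  proof -
    have "Suc (j - 2) = j - 1" "Suc (j - 1) = j" "j - 1 < length w" using j2 j len by auto
    then show ?thesis using hu[of "j - 2"] ht_Suc[of "j - 1" w] wj j(2) by simp
  qed
  \<comment> \<open>Height and position have equal parity, so the first return is at an even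
    position and u gets even length.\<close>
  have ev: "even j"
  proof -
    have "even (ht w x - int x)" if "x \<le> 2 * n" for x
      using that by (induction x) (auto simp: ht_Suc len)
    from this[OF j(3)] j(2) show ?thesis by simp
  qed
  define m where "m = j div 2 - 1"
  have m: "j = 2 * m + 2" using ev j2 by (auto simp: m_def elim!: evenE)
  have du: "dyck u m"
    unfolding dyck_def
  proof (intro conjI allI impI)
    fix x assume "x \<le> 2 * m"
    then show "0 \<le> ht u x" using before[of "Suc x"] hu[of x] m by simp
  qed (use lu m hu_end in auto)
  have hv: "ht w (2 * m + 2 + x) = ht v x" for x
    unfolding w by (rule ht_arch_right[OF du])
  have lv: "length v = 2 * (n - Suc m)" using m len by (simp add: v_def)
  have "dyck v (n - Suc m)"
    unfolding dyck_def
  proof (intro conjI allI impI)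
    fix x
    show "0 \<le> ht v x" using nonneg[of "2 * m + 2 + x"] hv[of x] by simp
  next
    show "ht v (2 * (n - Suc m)) = 0"
      proof -
      have "2 * m + 2 + 2 * (n - Suc m) = 2 * n" using j(3) m by simp
      then show ?thesis using hv[of "2 * (n - Suc m)"] dyck_ht_end[OF assms(1)] by simp
    qed
  qed (rule lv)
  moreover have "n = Suc (m + (n - Suc m))" using j m by simp
  ultimately show ?thesis using that w du by blast
qed

lemma dyck_induct [consumes 1, case_names Nil arch]:
  assumes "dyck w n"
    and "P [] 0"
    and "\<And>u m v k. dyck u m \<Longrightarrow> dyck v k \<Longrightarrow> P u m \<Longrightarrow> P v k \<Longrightarrow> P (arch u v) (Suc (m + k))"
  shows "P w n"
  using assms(1)
proof (induction n arbitrary: w rule: less_induct)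
  case (less n)
  show ?case
  proof (cases "w = []")
    case True
    then show ?thesis using less.prems assms(2) dyck_length by fastforce
  next
    case False
    from dyck_arch_decomp[OF less.prems False] obtain u v m k
      where "w = arch u v" "dyck u m" "dyck v k" "n = Suc (m + k)" .
    then show ?thesis using less.IH assms(3) by simp
  qed
qed

section \<open>Chords of an arch in terms of the chords of its parts\<close>

definition shift :: "nat \<Rightarrow> nat \<times> nat \<Rightarrow> nat \<times> nat" where
  "shift d c = (fst c + d, snd c + d)"

lemma inj_shift: "inj (shift d)"
  by (auto simp: shift_def inj_def prod_eq_iff)

lemma strictly_contains_shift [simp]:
  "strictly_contains (shift d c) (shift d e) = strictly_contains c e"
  by (simp add: shift_def strictly_contains_def)

lemma fst_shift [simp]: "fst (shift d c) = fst c + d" and snd_shift [simp]: "snd (shift d c) = snd c + d"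
  by (simp_all add: shift_def)

lemma chords_D:
  assumes "c \<in> chords w"
  shows "fst c < snd c" "snd c < length w" "w ! fst c" "\<not> w ! snd c" "ht w (Suc (snd c)) = ht w (fst c)"
    "\<And>k. fst c < k \<Longrightarrow> k \<le> snd c \<Longrightarrow> ht w (fst c) < ht w k"
  using assms by (auto simp: chords_def)

lemma chords_Nil [simp]: "chords [] = {}"
  by (simp add: chords_def)

lemma finite_chords: "finite (chords w)"
proof (rule finite_subset)
  show "chords w \<subseteq> {..<length w} \<times> {..<length w}" by (auto simp: chords_def)
qed simp

lemma chords_arch:
  assumes u: "dyck u m" and v: "dyck v k"
  shows "chords (arch u v) =
    insert (0, Suc (2 * m)) (shift 1 ` chords u \<union> shift (2 * m + 2) ` chords v)" (is "_ = ?R")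
proof (intro set_eqI iffI)
  note simps = ht_arch_inner[OF u] nth_arch_inner[OF u] nth_arch_close[OF u]
  note right = ht_arch_right[OF u] nth_arch_right[OF u]
  note len = dyck_length[OF u] dyck_length[OF v]
  fix c
  {
    assume c: "c \<in> chords (arch u v)"
    obtain i j where ij: "c = (i, j)" by (cases c)
    note D = chords_D[OF c, unfolded ij fst_conv snd_conv]
    show "c \<in> ?R"
    proof (cases rule: arch_cases[where i = i and m = m])
      case 1
      have "ht (arch u v) (Suc (Suc (2 * m))) = 0" using right(1)[of v 0] by simp
      then have "\<not> Suc (2 * m) < j" using D(6)[of "Suc (Suc (2 * m))"] 1 by auto
      moreover have "\<not> j < Suc (2 * m)"
      proof
        assume "j < Suc (2 * m)"
        then have "ht (arch u v) (Suc j) = 1 + ht u j" using simps(1)[of j] by simp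
        then show False using D(5) 1 dyck_ht_nonneg[OF u, of j] by simp
      qed
      ultimately show ?thesis using ij 1 by auto
    next
      case (2 x)
      have hi: "ht (arch u v) i = 1 + ht u x" using simps(1)[of x] 2 by simp
      \<comment> \<open>Otherwise the chord would pass the end of u, where the height is 1 and thus
        not above the height at which the chord opens.\<close>
      have "j \<le> 2 * m"
      proof (rule ccontr)
        assume "\<not> j \<le> 2 * m"
        then have "ht (arch u v) i < ht (arch u v) (Suc (2 * m))" using D(6)[of "Suc (2 * m)"] 2 by simp
        then show False using hi simps(1)[of "2 * m"] dyck_ht_end[OF u] dyck_ht_nonneg[OF u, of x] by simp
      qed
      moreover obtain y where y: "j = Suc y" using D(1) by (cases j) auto
      ultimately have y': "y < 2 * m" by simp
      have "(x, y) \<in> chords u"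
        unfolding chords_def
      proof (clarify, intro conjI allI impI)
        show "ht u (Suc y) = ht u x" using D(5) y y' hi simps(1)[of "Suc y"] by simp
        fix k assume k: "x < k \<and> k \<le> y"
        then show "ht u x < ht u k" using D(6)[of "Suc k"] 2 y y' hi simps(1)[of k] by simp
      qed (use D y y' 2 len simps in auto)
      then show ?thesis using ij 2 y by (force simp: shift_def)
    next
      case 3
      then show ?thesis using D(3) simps by simp
    next
      case (4 x)
      define y where "y = j - (2 * m + 2)"
      have y: "j = 2 * m + 2 + y" using D(1) 4 by (simp add: y_def)
      have "(x, y) \<in> chords v"
        unfolding chords_def
      proof (clarify, intro conjI allI impI)
        show "ht v (Suc y) = ht v x" using D(5) y 4 right(1)[of v "Suc y"] right(1)[of v x] by simp
        fix k assume k: "x < k \<and> k \<le> y"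
        then show "ht v x < ht v k" using D(6)[of "2 * m + 2 + k"] 4 y right(1)[of v k] right(1)[of v x] by simp
      qed (use D(1-4) y 4 len right(2)[of v x] right(2)[of v y] in auto)
      then show ?thesis using ij 4 y by (force simp: shift_def add.commute)
    qed
  }
  {
    assume "c \<in> ?R"
    then consider "c = (0, Suc (2 * m))" | d where "d \<in> chords u" "c = shift 1 d"
      | d where "d \<in> chords v" "c = shift (2 * m + 2) d" by blast
    then show "c \<in> chords (arch u v)"
    proof cases
      case 1
      have "0 < ht (arch u v) x" if "0 < x" "x \<le> Suc (2 * m)" for x
        using that simps(1)[of "x - 1"] dyck_ht_nonneg[OF u, of "x - 1"] by simp
      then show ?thesis unfolding 1 chords_def
        using len simps right(1)[of v 0] by (simp add: arch_def)
    next
      case 2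
      obtain i j where d: "d = (i, j)" by (cases d)
      note D = chords_D[OF 2(1), unfolded d fst_conv snd_conv]
      have "ht (arch u v) (Suc i) < ht (arch u v) x" if "Suc i < x" "x \<le> Suc j" for x
        using that D(1,2) D(6)[of "x - 1"] simps(1)[of "x - 1"] simps(1)[of i] len by simp
      then show ?thesis unfolding 2 d chords_def
        using D(1-5) len simps(1)[of i] simps(1)[of "Suc j"] simps(2)[of i] simps(2)[of j]
        by (simp add: shift_def)
    next
      case 3
      obtain i j where d: "d = (i, j)" by (cases d)
      note D = chords_D[OF 3(1), unfolded d fst_conv snd_conv]
      have "ht (arch u v) (2 * m + 2 + i) < ht (arch u v) x" if "2 * m + 2 + i < x" "x \<le> 2 * m + 2 + j" for x
      proof -
        have "x = 2 * m + 2 + (x - (2 * m + 2))" using that by simp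
        then show ?thesis
          using that D(6)[of "x - (2 * m + 2)"] right(1)[of v "x - (2 * m + 2)"] right(1)[of v i]
          by (metis add_le_cancel_left add_less_cancel_left)
      qed
      moreover have "ht (arch u v) (Suc (2 * m + 2 + j)) = ht (arch u v) (2 * m + 2 + i)"
        using D(5) right(1)[of v i] right(1)[of v "Suc j"] by simp
      ultimately show ?thesis unfolding 3 d chords_def
        using D(1-4) len right(2)[of v i] right(2)[of v j]
        by (auto simp: shift_def add.commute)
    qed
  }
qed

text \<open>A chord strictly inside \<open>e\<close> has a parent that is \<open>e\<close> or lies
  inside \<open>e\<close>: among the containers in that range, the one with least right end is
  innermost. Its right end is farther right than that of the chord, which gives the induction
  measure.\<close>

lemma subtree_edges_eq:
  assumes e: "e \<in> chords w"
  shows "subtree_edges w e = {c \<in> chords w. c = e \<or> strictly_contains e c}"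
proof -
  define r where "r = {(c', d). child_of w c' (Some d)}"
  have "c \<in> chords w \<and> (c = e \<or> strictly_contains e c)" if "(c, e) \<in> r\<^sup>*" for c
    using that
  proof (induction rule: converse_rtrancl_induct)
    case (step y z)
    then show ?case by (auto simp: r_def child_of_def strictly_contains_def)
  qed (use e in simp)
  moreover have "(c, e) \<in> r\<^sup>*" if "c \<in> chords w" "c = e \<or> strictly_contains e c" for c
    using that
  proof (induction "snd e - snd c" arbitrary: c rule: less_induct)
    case less
    show ?case
    proof (cases "c = e")
      case False
      then have ec: "strictly_contains e c" using less by simp
      define S where "S = {d \<in> chords w. strictly_contains d c \<and> (d = e \<or> strictly_contains e d)}"
      have "e \<in> S" using ec e by (simp add: S_def)
      then obtain d where d: "d \<in> S" "\<And>x. x \<in> S \<Longrightarrow> snd d \<le> snd x"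
        using arg_min_nat_lemma[of "\<lambda>x. x \<in> S" e snd] by (metis (full_types))
      have "child_of w c (Some d)"
        unfolding child_of_def using d(1) less.prems(1) d(2)
        by (fastforce simp: S_def strictly_contains_def)
      then have "(c, d) \<in> r" by (simp add: r_def)
      moreover have "(d, e) \<in> r\<^sup>*"
        using d(1) ec by (intro less.hyps) (auto simp: S_def strictly_contains_def)
      ultimately show ?thesis by (rule converse_rtrancl_into_rtrancl)
    qed simp
  qed
  ultimately show ?thesis unfolding subtree_edges_def r_def[symmetric] by blast
qed

context
  fixes u :: "bool list" and m :: nat
  assumes u: "dyck u m"
begin

lemma contains_arch:
  "c \<in> chords u \<Longrightarrow> strictly_contains (0, Suc (2 * m)) (shift 1 c)"
  "c \<in> chords u \<Longrightarrow> \<not> strictly_contains (shift 1 c) (0, Suc (2 * m))"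
  "\<not> strictly_contains (0, Suc (2 * m)) (shift (2 * m + 2) d)"
  "\<not> strictly_contains (shift (2 * m + 2) d) (0, Suc (2 * m))"
  "c \<in> chords u \<Longrightarrow> \<not> strictly_contains (shift 1 c) (shift (2 * m + 2) d)"
  "c \<in> chords u \<Longrightarrow> \<not> strictly_contains (shift (2 * m + 2) d) (shift 1 c)"
  "\<not> strictly_contains c' c'"
  using chords_D(1,2)[of c u] dyck_length[OF u]
  by (auto simp: strictly_contains_def)

lemma chords_arch_distinct:
  "(0, Suc (2 * m)) \<noteq> shift 1 c"
  "(0, Suc (2 * m)) \<noteq> shift (2 * m + 2) d"
  "c \<in> chords u \<Longrightarrow> shift 1 c \<noteq> shift (2 * m + 2) d"
  using chords_D(1,2)[of c u] dyck_length[OF u]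
  by (auto simp: shift_def)

end

section \<open>The product over the vertices\<close>

context
  fixes u v :: "bool list" and m k :: nat
  assumes u: "dyck u m" and v: "dyck v k"
begin


lemmas chords_uv = chords_arch[OF u v]
lemmas contains_uv = contains_arch[OF u]
lemmas distinct_uv = chords_arch_distinct[OF u] chords_arch_distinct[OF u, symmetric]

lemma shift_eq_iff: "shift d a = shift d b \<longleftrightarrow> a = b"
  using inj_shift by (metis injD)

lemma children_arch_None: "children (arch u v) None = insert (0, Suc (2 * m)) (shift (2 * m + 2) ` children v None)"
  unfolding children_def child_of_def chords_uv by (auto simp: contains_uv bex_Un image_iff simp del: One_nat_def add_2_eq_Suc')

lemma children_arch_outer: "children (arch u v) (Some (0, Suc (2 * m))) = shift 1 ` children u None"
  unfolding children_def child_of_def chords_uv by (auto simp: contains_uv distinct_uv bex_Un image_iff simp del: One_nat_def add_2_eq_Suc')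

lemma children_arch_inner:
  assumes "d \<in> chords u"
  shows "children (arch u v) (Some (shift 1 d)) = shift 1 ` children u (Some d)"
  unfolding children_def child_of_def chords_uv using assms
  by (auto simp: contains_uv distinct_uv bex_Un image_iff shift_eq_iff simp del: One_nat_def add_2_eq_Suc')

lemma children_arch_right:
  assumes "d \<in> chords v"
  shows "children (arch u v) (Some (shift (2 * m + 2) d)) = shift (2 * m + 2) ` children v (Some d)"
  unfolding children_def child_of_def chords_uv using assms
  by (auto simp: contains_uv distinct_uv bex_Un image_iff shift_eq_iff simp del: One_nat_def add_2_eq_Suc')

lemma N_sub_arch_inner:
  assumes "d \<in> chords u" shows "N_sub (arch u v) (shift 1 d) = N_sub u d"
proof -
  have "shift 1 d \<in> chords (arch u v)" using assms by (simp add: chords_uv)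
  then have "subtree_edges (arch u v) (shift 1 d) = shift 1 ` subtree_edges u d"
    unfolding subtree_edges_eq[OF \<open>shift 1 d \<in> chords (arch u v)\<close>] subtree_edges_eq[OF assms]
    using assms by (auto simp: contains_uv distinct_uv chords_uv shift_eq_iff simp del: One_nat_def add_2_eq_Suc')
  then show ?thesis by (simp add: N_sub_def card_image inj_on_subset[OF inj_shift])
qed

lemma N_sub_arch_right:
  assumes "d \<in> chords v" shows "N_sub (arch u v) (shift (2 * m + 2) d) = N_sub v d"
proof -
  have "shift (2 * m + 2) d \<in> chords (arch u v)" using assms by (simp add: chords_uv)
  then have "subtree_edges (arch u v) (shift (2 * m + 2) d) = shift (2 * m + 2) ` subtree_edges v d"
    unfolding subtree_edges_eq[OF \<open>shift (2 * m + 2) d \<in> chords (arch u v)\<close>] subtree_edges_eq[OF assms]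
    using assms by (auto simp: contains_uv distinct_uv chords_uv shift_eq_iff simp del: One_nat_def add_2_eq_Suc')
  then show ?thesis by (simp add: N_sub_def card_image inj_on_subset[OF inj_shift])
qed

lemma card_chords_arch: "card (chords (arch u v)) = Suc (card (chords u) + card (chords v))"
proof -
  have "card (shift 1 ` chords u \<union> shift (2 * m + 2) ` chords v) = card (chords u) + card (chords v)"
    by (subst card_Un_disjoint) (auto simp: distinct_uv finite_chords card_image inj_on_subset[OF inj_shift] simp del: One_nat_def add_2_eq_Suc')
  moreover have "(0, Suc (2 * m)) \<notin> shift 1 ` chords u \<union> shift (2 * m + 2) ` chords v" using distinct_uv by auto
  ultimately show ?thesis by (simp add: chords_uv finite_chords)
qed

lemma N_sub_arch_outer: "N_sub (arch u v) (0, Suc (2 * m)) = Suc (card (chords u))"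
proof -
  have outer: "(0, Suc (2 * m)) \<in> chords (arch u v)" by (simp add: chords_uv)
  have "subtree_edges (arch u v) (0, Suc (2 * m)) = insert (0, Suc (2 * m)) (shift 1 ` chords u)"
    unfolding subtree_edges_eq[OF outer] by (auto simp: contains_uv distinct_uv chords_uv simp del: One_nat_def add_2_eq_Suc')
  moreover have "(0, Suc (2 * m)) \<notin> shift 1 ` chords u" using distinct_uv by auto
  ultimately show ?thesis
    by (simp add: N_sub_def finite_chords card_image inj_on_subset[OF inj_shift])
qed

end

lemma card_chords: "dyck w n \<Longrightarrow> card (chords w) = n"
  by (induction rule: dyck_induct) (simp_all add: card_chords_arch)

definition vertex_factor :: "bool list \<Rightarrow> (nat \<times> nat) option \<Rightarrow> int poly" where
  "vertex_factor w v = q_multinom (M_vert w v) (N_sub w) (children w v)"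

lemma children_subset: "children w x \<subseteq> chords w"
  by (auto simp: children_def child_of_def)

lemma finite_children: "finite (children w x)"
  using children_subset finite_chords by (rule finite_subset)

lemma vertex_factor_shift:
  assumes "children w x = shift d ` children w' y"
    and "\<And>c. c \<in> children w' y \<Longrightarrow> N_sub w (shift d c) = N_sub w' c"
  shows "vertex_factor w x = vertex_factor w' y"
proof -
  have inj: "inj_on (shift d) A" for A by (rule inj_on_subset[OF inj_shift]) simp
  show ?thesis unfolding vertex_factor_def q_multinom_def M_vert_def assms(1)
    by (simp add: sum.reindex[OF inj] prod.reindex[OF inj] assms(2))
qed

text \<open>The denominator of the q-multinomial at the root, kept apart because \<open>div\<close>
  carries no information until divisibility is known.\<close>

definition root_fact :: "bool list \<Rightarrow> int poly" where
  "root_fact w = (\<Prod>c\<in>children w None. q_fact (N_sub w c))"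

lemma root_fact_neq_0: "root_fact w \<noteq> 0"
  by (simp add: root_fact_def finite_children q_fact_neq_0)

lemma children_arch_None_sums:
  assumes "dyck u m" "dyck v k"
  shows "M_vert (arch u v) None = Suc m + M_vert v None"
    and "root_fact (arch u v) = q_fact (Suc m) * root_fact v"
proof -
  note N = N_sub_arch_outer[OF assms] N_sub_arch_right[OF assms]
  have inj: "inj_on (shift d) A" for A d by (rule inj_on_subset[OF inj_shift]) simp
  have 1: "(0, Suc (2 * m)) \<notin> shift (2 * m + 2) ` children v None"
    using chords_arch_distinct(2)[OF assms(1)] by blast
  have 2: "N_sub (arch u v) (shift (2 * m + 2) c) = N_sub v c" if "c \<in> children v None" for c
    using that N(2) children_subset by blast
  have 3: "N_sub (arch u v) (0, Suc (2 * m)) = Suc m" using N(1) card_chords[OF assms(1)] by simp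
  show "M_vert (arch u v) None = Suc m + M_vert v None"
    unfolding M_vert_def children_arch_None[OF assms]
    using 1 2 3 by (simp add: finite_children sum.reindex[OF inj])
  show "root_fact (arch u v) = q_fact (Suc m) * root_fact v"
    unfolding root_fact_def children_arch_None[OF assms]
    using 1 2 3 by (simp add: finite_children prod.reindex[OF inj])
qed

lemma children_Nil [simp]: "children [] x = {}"
  by (simp add: children_def child_of_def)

lemma M_vert_None: "dyck w n \<Longrightarrow> M_vert w None = n"
  by (induction rule: dyck_induct) (simp_all add: children_arch_None_sums M_vert_def[of "[]"])

lemma dyck_arch:
  assumes u: "dyck u m" and v: "dyck v k"
  shows "dyck (arch u v) (Suc (m + k))"
  unfolding dyck_def
proof (intro conjI allI impI)
  note inner = ht_arch_inner[OF u] and right = ht_arch_right[OF u]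
  fix x
  show "0 \<le> ht (arch u v) x"
  proof (cases rule: arch_cases[where i = x and m = m])
    case (2 y)
    then show ?thesis using inner[of y] dyck_ht_nonneg[OF u, of y] by simp
  next
    case 3
    then show ?thesis using inner[of "2 * m"] dyck_ht_nonneg[OF u, of "2 * m"] by simp
  next
    case (4 y)
    then show ?thesis using right[of v y] dyck_ht_nonneg[OF v, of y] by simp
  qed simp
  show "ht (arch u v) (2 * Suc (m + k)) = 0"
    using right[of v "2 * k"] dyck_ht_end[OF v] by (simp add: algebra_simps)
qed (use u v in \<open>simp add: dyck_length\<close>)

lemma vertex_factor_None_eq_div:
  "dyck w n \<Longrightarrow> vertex_factor w None = q_fact n div root_fact w"
  by (simp add: vertex_factor_def q_multinom_def root_fact_def M_vert_None)

lemma q_fact_arch: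
  assumes "dyck u m" "dyck v k" "vertex_factor v None * root_fact v = q_fact k"
  shows "q_fact (Suc (m + k)) = qbin (Suc m) k * vertex_factor v None * root_fact (arch u v)"
proof -
  have "qbin (Suc m) k * vertex_factor v None * root_fact (arch u v)
    = qbin (Suc m) k * q_fact (Suc m) * (vertex_factor v None * root_fact v)"
    by (simp add: children_arch_None_sums[OF assms(1,2)] mult_ac)
  also have "\<dots> = q_fact (Suc (m + k))"
    unfolding assms(3) using qbin_mult_q_facts[of "Suc m" k] by simp
  finally show ?thesis by simp
qed

text \<open>Exactness of the division. A new first child of size m + 1 contributes the Gaussian
  binomial \<open>qbin (Suc m) k\<close>, a polynomial, so divisibility passes from v to the arch.
  The root suffices, since any other vertex is the root of an inner word up to translation.\<close>

lemma vertex_factor_None_mult: "dyck w n \<Longrightarrow> vertex_factor w None * root_fact w = q_fact n"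
proof (induction rule: dyck_induct)
  case Nil
  show ?case by (simp add: vertex_factor_None_eq_div[OF dyck_Nil] root_fact_def)
next
  case (arch u m v k)
  then show ?case
    using q_fact_arch[OF arch.hyps] vertex_factor_None_eq_div[OF dyck_arch[OF arch.hyps]]
      root_fact_neq_0[of "arch u v"] by simp
qed

lemma vertex_factor_None_arch:
  assumes "dyck u m" "dyck v k"
  shows "vertex_factor (arch u v) None = qbin (Suc m) k * vertex_factor v None"
  using q_fact_arch[OF assms vertex_factor_None_mult[OF assms(2)]]
    vertex_factor_None_eq_div[OF dyck_arch[OF assms]] root_fact_neq_0[of "arch u v"] by simp

definition tree_gf :: "bool list \<Rightarrow> int poly" where
  "tree_gf w = (\<Prod>x\<in>vertices w. vertex_factor w x)"

lemma tree_gf_Nil [simp]: "tree_gf [] = 1"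
  by (simp add: tree_gf_def vertices_def vertex_factor_def q_multinom_def M_vert_def)

lemma tree_gf_split: "tree_gf w = vertex_factor w None * (\<Prod>c\<in>chords w. vertex_factor w (Some c))"
  unfolding tree_gf_def vertices_def
  by (subst prod.insert) (auto simp: finite_chords prod.reindex)

text \<open>Only the root mixes the two parts: it gains a child of size m + 1 beside the k edges of
  v. The lower end of the outer chord takes over the role of the root of u.\<close>

lemma tree_gf_arch:
  assumes "dyck u m" "dyck v k"
  shows "tree_gf (arch u v) = qbin (Suc m) k * tree_gf u * tree_gf v"
proof -
  let ?w = "arch u v"
  have inj: "inj_on (shift d) A" for A d by (rule inj_on_subset[OF inj_shift]) simp
  note dist = chords_arch_distinct[OF assms(1)] chords_arch_distinct[OF assms(1), symmetric]
  have f0: "vertex_factor ?w (Some (0, Suc (2 * m))) = vertex_factor u None"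
    using children_subset by (intro vertex_factor_shift[OF children_arch_outer[OF assms]] N_sub_arch_inner[OF assms]) blast
  have fu: "vertex_factor ?w (Some (shift 1 c)) = vertex_factor u (Some c)" if "c \<in> chords u" for c
    using children_subset by (intro vertex_factor_shift[OF children_arch_inner[OF assms that]] N_sub_arch_inner[OF assms]) blast
  have fv: "vertex_factor ?w (Some (shift (2 * m + 2) c)) = vertex_factor v (Some c)" if "c \<in> chords v" for c
    using children_subset by (intro vertex_factor_shift[OF children_arch_right[OF assms that]] N_sub_arch_right[OF assms]) blast
  have "(\<Prod>c\<in>chords ?w. vertex_factor ?w (Some c)) =
    vertex_factor ?w (Some (0, Suc (2 * m))) * ((\<Prod>c\<in>shift 1 ` chords u. vertex_factor ?w (Some c))
      * (\<Prod>c\<in>shift (2 * m + 2) ` chords v. vertex_factor ?w (Some c)))"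
    unfolding chords_arch[OF assms]
    by (subst prod.insert; (subst prod.union_disjoint)?)
      (auto simp: dist finite_chords simp del: One_nat_def add_2_eq_Suc')
  also have "\<dots> = vertex_factor u None * ((\<Prod>c\<in>chords u. vertex_factor u (Some c))
      * (\<Prod>c\<in>chords v. vertex_factor v (Some c)))"
    unfolding prod.reindex[OF inj] o_def using f0 fu fv by simp
  finally show ?thesis
    unfolding tree_gf_split vertex_factor_None_arch[OF assms] by (simp add: mult_ac)
qed

lemma tree_gf_eq_branching:
  "tree_gf w = (\<Prod>x\<in>{x \<in> vertices w. 2 \<le> card (children w x)}.
     q_multinom (M_vert w x) (N_sub w) (children w x))"
proof -
  have "vertex_factor w x = 1" if few: "\<not> 2 \<le> card (children w x)" for x
  proof -
    consider "card (children w x) = 0" | "card (children w x) = 1" using few by linarith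
    then show ?thesis
    proof cases
      case 1
      then show ?thesis using finite_children[of w x]
        by (simp add: vertex_factor_def q_multinom_def M_vert_def)
    next
      case 2
      then obtain c where "children w x = {c}" by (metis card_1_singletonE)
      then show ?thesis by (simp add: vertex_factor_def q_multinom_def M_vert_def q_fact_neq_0)
    qed
  qed
  then have "tree_gf w = (\<Prod>x\<in>{x \<in> vertices w. 2 \<le> card (children w x)}. vertex_factor w x)"
    unfolding tree_gf_def
    by (intro prod.mono_neutral_right) (auto simp: vertices_def finite_chords)
  then show ?thesis by (simp add: vertex_factor_def)
qed

section \<open>The transfer matrix\<close>

text \<open>A configuration lists the pairs \<open>(j x, m (x + 1))\<close> for the steps \<open>x\<close> of the word; \<open>a\<close> and \<open>b\<close> are the
  values of \<open>m\<close> at the two ends and \<open>s\<close> is a lower bound for the labels \<open>j\<close>.\<close>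
fun walk :: "bool list \<Rightarrow> int \<Rightarrow> int \<Rightarrow> int \<Rightarrow> (int \<times> int) list \<Rightarrow> bool" where
  "walk [] s a b [] \<longleftrightarrow> a = b \<and> s \<le> a"
| "walk (c # w) s a b ((j, l) # xs) \<longleftrightarrow> s \<le> j \<and> j \<le> a \<and> j \<le> l \<and>
     (if c then l \<le> a \<and> a \<le> l + 1 else a \<le> l \<and> l \<le> a + 1) \<and> walk w s l b xs"
| "walk _ s a b _ \<longleftrightarrow> False"

text \<open>Every step strictly inside a chord belongs to an inner chord, so comparing labels of
  steps is the monotonicity of labels along the tree.\<close>

definition chordal :: "bool list \<Rightarrow> (int \<times> int) list \<Rightarrow> bool" where
  "chordal w xs \<longleftrightarrow> (\<forall>c\<in>chords w. fst (xs ! fst c) = fst (xs ! snd c) \<and>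
     (\<forall>x. fst c < x \<and> x < snd c \<longrightarrow> fst (xs ! fst c) \<le> fst (xs ! x)))"

definition configs :: "bool list \<Rightarrow> int \<Rightarrow> int \<Rightarrow> int \<Rightarrow> (int \<times> int) list set" where
  "configs w s a b = {xs. walk w s a b xs \<and> chordal w xs}"

text \<open>Both steps of a chord carry its label, which must be subtracted once; doing so at the up
  step keeps each summand nonnegative, as \<open>j \<le> l\<close>.\<close>

fun weight :: "bool list \<Rightarrow> (int \<times> int) list \<Rightarrow> int" where
  "weight (c # w) ((j, l) # xs) = (if c then l - j else l) + weight w xs"
| "weight _ _ = 0"

definition config_gf :: "bool list \<Rightarrow> int \<Rightarrow> int \<Rightarrow> int \<Rightarrow> int poly" where
  "config_gf w s a b = (\<Sum>xs\<in>configs w s a b. qp (weight w xs))"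

lemma walk_length: "walk w s a b xs \<Longrightarrow> length xs = length w"
  by (induction w s a b xs rule: walk.induct) auto

lemma walk_ge: "walk w s a b xs \<Longrightarrow> s \<le> a \<and> s \<le> b"
  by (induction w s a b xs rule: walk.induct) auto

lemma walk_end_le: "walk w s a b xs \<Longrightarrow> b \<le> a + int (length w)"
  by (induction w s a b xs rule: walk.induct) (auto split: if_splits)

lemma walk_end_unique: "walk w s a b xs \<Longrightarrow> walk w s' a b' xs \<Longrightarrow> b = b'"
  by (induction w s a b xs rule: walk.induct) auto

lemma walk_set: "walk w s a b xs \<Longrightarrow> set xs \<subseteq> {s..a + int (length w)} \<times> {s..a + int (length w)}"
  by (induction w s a b xs rule: walk.induct) (fastforce split: if_splits)+

lemma walk_append:
  "length xs = length u \<Longrightarrow>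
   walk (u @ v) s a b (xs @ ys) \<longleftrightarrow> (\<exists>c. walk u s a c xs \<and> walk v s c b ys)"
proof (induction u arbitrary: a xs)
  case Nil
  then show ?case using walk_ge by fastforce
next
  case (Cons p u)
  then obtain j l xs' where "xs = (j, l) # xs'" by (metis Suc_length_conv surj_pair)
  then show ?case using Cons by auto
qed

text \<open>Columns after the first need no check, because each label is a lower bound for the
  columns on both sides of its step. This lets the label of an enclosing chord serve as the floor of
  the word inside.\<close>

lemma walk_raise:
  assumes "s \<le> t"
  shows "walk w t a b xs \<longleftrightarrow> walk w s a b xs \<and> t \<le> a \<and> (\<forall>x\<in>set xs. t \<le> fst x)"
  using assms by (induction w s a b xs rule: walk.induct) auto

lemma weight_append:
  "length xs = length u \<Longrightarrow> weight (u @ v) (xs @ ys) = weight u xs + weight v ys"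
proof (induction u arbitrary: xs)
  case (Cons p u)
  then obtain j l xs' where "xs = (j, l) # xs'" by (metis Suc_length_conv surj_pair)
  then show ?case using Cons by auto
qed simp

lemma weight_nonneg: "walk w s a b xs \<Longrightarrow> 0 \<le> s \<Longrightarrow> 0 \<le> weight w xs"
  by (induction w s a b xs rule: walk.induct) (auto split: if_splits)

lemma finite_configs: "finite (configs w s a b)"
proof (rule finite_subset)
  let ?R = "{s..a + int (length w)}"
  show "configs w s a b \<subseteq> {xs. set xs \<subseteq> ?R \<times> ?R \<and> length xs = length w}"
    using walk_set walk_length unfolding configs_def by blast
  show "finite {xs. set xs \<subseteq> ?R \<times> ?R \<and> length xs = length w}"
    by (intro finite_lists_length_eq) simp
qed

lemma chordal_arch:
  assumes u: "dyck u m" and v: "dyck v k" and ys: "length ys = 2 * m"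
  shows "chordal (arch u v) ((J, a) # ys @ (J', c) # zs) \<longleftrightarrow>
    J = J' \<and> (\<forall>y\<in>set ys. J \<le> fst y) \<and> chordal u ys \<and> chordal v zs" (is "chordal _ ?xs \<longleftrightarrow> _")
proof -
  have n0: "?xs ! 0 = (J, a)" and n1: "?xs ! Suc (2 * m) = (J', c)"
    using ys by (simp_all add: nth_append)
  have ni: "?xs ! (Suc x) = ys ! x" if "x < 2 * m" for x
    using that ys by (simp add: nth_append)
  have nr: "?xs ! (2 * m + 2 + x) = zs ! x" for x
    using ys by (simp add: nth_append)
  define P where "P xs c \<longleftrightarrow> fst (xs ! fst c) = fst (xs ! snd c) \<and>
     (\<forall>x. fst c < x \<and> x < snd c \<longrightarrow> fst (xs ! fst c) \<le> fst (xs ! x))"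
    for xs :: "(int \<times> int) list" and c :: "nat \<times> nat"
  have P0: "P ?xs (0, Suc (2 * m)) \<longleftrightarrow> J = J' \<and> (\<forall>y\<in>set ys. J \<le> fst y)"
  proof -
    have "(\<forall>x. 0 < x \<and> x < Suc (2 * m) \<longrightarrow> J \<le> fst (?xs ! x)) \<longleftrightarrow> (\<forall>x<2 * m. J \<le> fst (ys ! x))"
    proof (intro iffI allI impI)
      fix x assume "\<forall>x. 0 < x \<and> x < Suc (2 * m) \<longrightarrow> J \<le> fst (?xs ! x)" "x < 2 * m"
      then show "J \<le> fst (ys ! x)" using ni[of x] by (metis Suc_less_eq zero_less_Suc)
    next
      fix x assume *: "\<forall>x<2 * m. J \<le> fst (ys ! x)" "0 < x \<and> x < Suc (2 * m)"
      then obtain y where "x = Suc y" by (cases x) auto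
      then show "J \<le> fst (?xs ! x)" using * ni[of y] by simp
    qed
    then show ?thesis unfolding P_def fst_conv snd_conv n0 n1
      using ys by (auto simp: all_set_conv_all_nth)
  qed
  have Pu: "P ?xs (shift 1 c) \<longleftrightarrow> P ys c" if "c \<in> chords u" for c
  proof -
    have c: "fst c < snd c" "snd c < 2 * m" using chords_D(1,2)[OF that] dyck_length[OF u] by auto
    have "(\<forall>x. Suc (fst c) < x \<and> x < Suc (snd c) \<longrightarrow> fst (ys ! fst c) \<le> fst (?xs ! x))
      \<longleftrightarrow> (\<forall>x. fst c < x \<and> x < snd c \<longrightarrow> fst (ys ! fst c) \<le> fst (ys ! x))"
    proof (intro iffI allI impI)
      fix x assume "\<forall>x. Suc (fst c) < x \<and> x < Suc (snd c) \<longrightarrow> fst (ys ! fst c) \<le> fst (?xs ! x)"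
        "fst c < x \<and> x < snd c"
      then show "fst (ys ! fst c) \<le> fst (ys ! x)" using ni[of x] c
        by (metis Suc_less_eq less_trans)
    next
      fix x assume *: "\<forall>x. fst c < x \<and> x < snd c \<longrightarrow> fst (ys ! fst c) \<le> fst (ys ! x)"
        "Suc (fst c) < x \<and> x < Suc (snd c)"
      then obtain y where "x = Suc y" by (cases x) auto
      then show "fst (ys ! fst c) \<le> fst (?xs ! x)" using * ni[of y] c by simp
    qed
    then show ?thesis unfolding P_def fst_shift snd_shift add_0_right Suc_eq_plus1[symmetric]
      using ni[of "fst c"] ni[of "snd c"] c by simp
  qed
  have Pv: "P ?xs (shift (2 * m + 2) c) \<longleftrightarrow> P zs c" for c
  proof -
    have "(\<forall>x. fst c + (2 * m + 2) < x \<and> x < snd c + (2 * m + 2) \<longrightarrow> fst (zs ! fst c) \<le> fst (?xs ! x))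
      \<longleftrightarrow> (\<forall>x. fst c < x \<and> x < snd c \<longrightarrow> fst (zs ! fst c) \<le> fst (zs ! x))"
    proof (intro iffI allI impI)
      fix x assume *: "\<forall>x. fst c + (2 * m + 2) < x \<and> x < snd c + (2 * m + 2) \<longrightarrow> fst (zs ! fst c) \<le> fst (?xs ! x)"
        "fst c < x \<and> x < snd c"
      from *(1)[rule_format, of "2 * m + 2 + x"] *(2) show "fst (zs ! fst c) \<le> fst (zs ! x)"
        unfolding nr by simp
    next
      fix x assume *: "\<forall>x. fst c < x \<and> x < snd c \<longrightarrow> fst (zs ! fst c) \<le> fst (zs ! x)"
        "fst c + (2 * m + 2) < x \<and> x < snd c + (2 * m + 2)"
      define y where "y = x - (2 * m + 2)"
      have y: "x = 2 * m + 2 + y" using *(2) unfolding y_def by linarith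
      from *(1)[rule_format, of y] *(2) show "fst (zs ! fst c) \<le> fst (?xs ! x)"
        unfolding y nr by simp
    qed
    then show ?thesis unfolding P_def fst_shift snd_shift
      unfolding nr[unfolded add.commute[of "2 * m + 2"]] by simp
  qed
  have P: "chordal w xs \<longleftrightarrow> (\<forall>c\<in>chords w. P xs c)" for w xs
    unfolding chordal_def P_def ..
  show ?thesis unfolding P chords_arch[OF u v]
    by (simp add: ball_Un P0 Pu Pv del: One_nat_def add_2_eq_Suc')
qed

text \<open>Here \<open>a'\<close> and \<open>b'\<close> are the columns just inside the outer chord
  and \<open>c\<close> is the column just after it; the label \<open>J\<close> becomes the floor of
  u. The bound \<open>B\<close> keeps the range of \<open>c\<close> finite: a column grows by at
  most one per step.\<close>

lemma configs_arch:
  assumes u: "dyck u m" and v: "dyck v k" and B: "a + int (2 * (m + 1)) \<le> B"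
  shows "configs (arch u v) s a b = (\<lambda>(c, J, a', b', ys, zs). (J, a') # ys @ (J, c) # zs) `
    (SIGMA c:{s..B}. SIGMA J:{s..a}. SIGMA a':{a - 1, a}. SIGMA b':{c - 1, c}.
       configs u J a' b' \<times> configs v s c b)" (is "_ = ?f ` ?S")
proof (intro set_eqI iffI)
  fix xs assume "xs \<in> configs (arch u v) s a b"
  then have walk: "walk (True # u @ False # v) s a b xs" and chordal: "chordal (arch u v) xs"
    by (auto simp: configs_def arch_def)
  note len = dyck_length[OF u] dyck_length[OF v] walk_length[OF walk]
  obtain J a' xs' where xs': "xs = (J, a') # xs'" using len by (cases xs) auto
  define ys where "ys = take (2 * m) xs'"
  have lys: "length ys = 2 * m" using len xs' by (simp add: ys_def)
  have "drop (2 * m) xs' \<noteq> []" using len xs' by simp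
  then obtain J' c zs where "drop (2 * m) xs' = (J', c) # zs" by (metis neq_Nil_conv surj_pair)
  then have xs: "xs = (J, a') # ys @ (J', c) # zs"
    using xs' by (metis append_take_drop_id ys_def)
  from chordal[unfolded xs chordal_arch[OF u v lys]]
  have ch: "J' = J" "\<forall>y\<in>set ys. J \<le> fst y" "chordal u ys" "chordal v zs" by auto
  from walk[unfolded xs] obtain b' where w: "s \<le> J" "J \<le> a" "J \<le> a'" "a' \<le> a" "a \<le> a' + 1"
      "walk u s a' b' ys" "J \<le> b'" "J \<le> c" "b' \<le> c" "c \<le> b' + 1" "walk v s c b zs"
    using lys len ch(1) by (auto simp: walk_append)
  have "walk u J a' b' ys" using walk_raise[OF w(1)] w ch by blast
  moreover have "c \<le> B" using walk_end_le[OF w(6)] w B len by simp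
  ultimately have "(c, J, a', b', ys, zs) \<in> ?S" using w ch by (auto simp: configs_def)
  then show "xs \<in> ?f ` ?S" unfolding xs ch(1)
    by (rule rev_image_eqI) simp
next
  fix xs assume "xs \<in> ?f ` ?S"
  then obtain p where p: "p \<in> ?S" "xs = ?f p" by blast
  obtain c J a' b' ys zs where "p = (c, J, a', b', ys, zs)" by (metis prod_cases6)
  then have S: "(c, J, a', b', ys, zs) \<in> ?S" and xs: "xs = (J, a') # ys @ (J, c) # zs"
    using p by simp_all
  then have w: "s \<le> J" "J \<le> a" "a' = a - 1 \<or> a' = a" "b' = c - 1 \<or> b' = c"
     "walk u J a' b' ys" "chordal u ys" "walk v s c b zs" "chordal v zs"
    by (auto simp: configs_def)
  have lys: "length ys = length u" using walk_length[OF w(5)] .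
  have r: "walk u s a' b' ys" "\<forall>y\<in>set ys. J \<le> fst y" using walk_raise[OF w(1)] w(5) by blast+
  have "walk (arch u v) s a b xs"
    unfolding arch_def xs using w r(1) lys walk_ge[OF w(5)] by (auto simp: walk_append)
  moreover have "chordal (arch u v) xs"
    unfolding xs using chordal_arch[OF u v] lys dyck_length[OF u] r(2) w by simp
  ultimately show "xs \<in> configs (arch u v) s a b" by (simp add: configs_def)
qed

lemma config_gf_arch:
  assumes u: "dyck u m" and v: "dyck v k" and s: "0 \<le> s" and B: "a + int (2 * (m + 1)) \<le> B"
  shows "config_gf (arch u v) s a b = (\<Sum>c\<in>{s..B}. (\<Sum>J\<in>{s..a}. \<Sum>a'\<in>{a - 1, a}. \<Sum>b'\<in>{c - 1, c}.
     qp (a' - J + c) * config_gf u J a' b') * config_gf v s c b)"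
proof -
  let ?f = "\<lambda>(c, J, a', b', ys, zs). (J, a') # ys @ (J, c) # zs"
  let ?S = "SIGMA c:{s..B}. SIGMA J:{s..a}. SIGMA a':{a - 1, a}. SIGMA b':{c - 1, c}.
       configs u J a' b' \<times> configs v s c b"
  have inj: "inj_on ?f ?S"
  proof (rule inj_onI)
    fix p p' assume p: "p \<in> ?S" "p' \<in> ?S" "?f p = ?f p'"
    obtain c J a' b' ys zs where P: "p = (c, J, a', b', ys, zs)" by (metis prod_cases6)
    obtain d L e' f' ys' zs' where P': "p' = (d, L, e', f', ys', zs')" by (metis prod_cases6)
    have w: "walk u J a' b' ys" "walk u L e' f' ys'" using p(1,2) unfolding P P' by (auto simp: configs_def)
    have "length ys = length ys'" using w by (simp add: walk_length)
    then have eq: "J = L" "a' = e'" "ys = ys'" "c = d" "zs = zs'" using p(3) unfolding P P' by auto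
    \<comment> \<open>The list does not display \<open>b'\<close>, but it is the end value of the
      inner walk.\<close>
    then have "b' = f'" using walk_end_unique w by blast
    then show "p = p'" using eq P P' by simp
  qed
  have "config_gf (arch u v) s a b = (\<Sum>p\<in>?S. qp (weight (arch u v) (?f p)))"
    unfolding config_gf_def configs_arch[OF u v B] by (simp add: sum.reindex[OF inj])
  also have "\<dots> = (\<Sum>(c, J, a', b', ys, zs)\<in>?S. qp (a' - J + c) * qp (weight u ys) * qp (weight v zs))"
  proof (intro sum.cong refl, clarify)
    fix c J a' b' ys zs
    assume "c \<in> {s..B}" "J \<in> {s..a}" "a' \<in> {a - 1, a}" "b' \<in> {c - 1, c}"
      "ys \<in> configs u J a' b'" "zs \<in> configs v s c b"
    then have w: "walk u J a' b' ys" "walk v s c b zs" "0 \<le> J" "0 \<le> c" using s by (auto simp: configs_def)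
    note nn = weight_nonneg[OF w(1,3)] weight_nonneg[OF w(2) s]
    have "J \<le> a'" using walk_ge[OF w(1)] by simp
    then have "qp ((a' - J + c) + weight u ys + weight v zs) = qp (a' - J + c) * qp (weight u ys) * qp (weight v zs)"
      using nn w by (simp add: qp_add)
    moreover have "weight (arch u v) ((J, a') # ys @ (J, c) # zs) = (a' - J + c) + weight u ys + weight v zs"
      using walk_length[OF w(1)] by (simp add: arch_def weight_append)
    ultimately show "qp (weight (arch u v) ((J, a') # ys @ (J, c) # zs)) = qp (a' - J + c) * qp (weight u ys) * qp (weight v zs)"
      by simp
  qed
  also have "\<dots> = (\<Sum>c\<in>{s..B}. \<Sum>J\<in>{s..a}. \<Sum>a'\<in>{a - 1, a}. \<Sum>b'\<in>{c - 1, c}.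
      \<Sum>ys\<in>configs u J a' b'. \<Sum>zs\<in>configs v s c b. qp (a' - J + c) * qp (weight u ys) * qp (weight v zs))"
    by (simp add: sum.Sigma finite_configs split_def del: sum.insert)
  also have "\<dots> = (\<Sum>c\<in>{s..B}. \<Sum>J\<in>{s..a}. \<Sum>a'\<in>{a - 1, a}. \<Sum>b'\<in>{c - 1, c}.
     qp (a' - J + c) * config_gf u J a' b' * config_gf v s c b)"
    unfolding config_gf_def mult.assoc sum_product
    unfolding sum_distrib_left ..
  finally show ?thesis by (simp only: sum_distrib_right)
qed

text \<open>The transfer matrix of an up step, a word with matrix \<open>kernel m\<close> and a down
  step, when the enclosing chord has label 0.\<close>

definition nest :: "nat \<Rightarrow> int \<Rightarrow> int \<Rightarrow> int poly" where
  "nest m a b = qp b * (qp a * (kernel m a b + kernel m a (b - 1))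
        + qp (a - 1) * (kernel m (a - 1) b + kernel m (a - 1) (b - 1)))"

text \<open>Raising the outer label by one moves both ends by one at the cost of
  \<open>qv ^ Suc m\<close>. The sum unrolls \<open>kernel_Suc\<close>: it is the geometric series
  of 1 / (1 - q^(m+1) x y).\<close>

lemma sum_nest:
  assumes "0 \<le> s"
  shows "(\<Sum>J\<in>{s..a}. qp (J * int (Suc m)) * nest m (a - J) (b - J))
    = qp (s * int (Suc m)) * kernel (Suc m) (a - s) (b - s)"
  using assms
proof (induction "nat (a + 1 - s)" arbitrary: s)
  case 0
  then show ?case by (simp add: kernel_neg)
next
  case (Suc l)
  then have "{s..a} = insert s {s + 1..a}" by auto
  moreover have "(\<Sum>J\<in>{s + 1..a}. qp (J * int (Suc m)) * nest m (a - J) (b - J))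
    = qp ((s + 1) * int (Suc m)) * kernel (Suc m) (a - (s + 1)) (b - (s + 1))"
    using Suc by (intro Suc.hyps) auto
  moreover have "qp ((s + 1) * int (Suc m)) = qp (s * int (Suc m)) * qv ^ Suc m"
    using Suc.prems qp_add[of "s * int (Suc m)" "int (Suc m)"]
    unfolding distrib_right qp_of_nat by simp
  ultimately have "(\<Sum>J\<in>{s..a}. qp (J * int (Suc m)) * nest m (a - J) (b - J))
     = qp (s * int (Suc m)) * (qv ^ Suc m * kernel (Suc m) (a - s - 1) (b - s - 1) + nest m (a - s) (b - s))"
    by (simp add: algebra_simps)
  also have "\<dots> = qp (s * int (Suc m)) * kernel (Suc m) (a - s) (b - s)"
    unfolding kernel_Suc[of m "a - s"] nest_def ..
  finally show ?case .
qed

lemma sum_enclosed: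
  assumes s: "0 \<le> s"
  shows "(\<Sum>J\<in>{s..a}. \<Sum>a'\<in>{a - 1, a}. \<Sum>b'\<in>{c - 1, c}.
     qp (a' - J + c) * (qp (J * int m) * g * kernel m (a' - J) (b' - J)))
   = qp (s * int (Suc m)) * g * kernel (Suc m) (a - s) (c - s)"
proof -
  have term_eq: "qp (a' - J + c) * (qp (J * int m) * g * kernel m (a' - J) (b' - J))
      = g * (qp (J * int (Suc m)) * (qp (c - J) * (qp (a' - J) * kernel m (a' - J) (b' - J))))"
    if "0 \<le> J" "b' \<le> c" for a' b' J
  proof (cases "a' - J < 0 \<or> b' - J < 0")
    case False
    have "qp (a' - J + c) * qp (J * int m) = qp (a' - J + c + J * int m)"
      by (rule qp_add[symmetric]) (use False that in auto)
    \<comment> \<open>Measuring both columns from \<open>J\<close> leaves one extra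
      \<open>J\<close>: the floor now counts for m + 1 chords instead of the m inner ones.\<close>
    also have "a' - J + c + J * int m = J * int (Suc m) + (c - J) + (a' - J)"
      by (simp add: algebra_simps)
    also have "qp \<dots> = qp (J * int (Suc m)) * qp (c - J) * qp (a' - J)"
    proof -
      have "0 \<le> J * int (Suc m)" "0 \<le> c - J" "0 \<le> a' - J" using False that by auto
      then show ?thesis by (simp only: qp_add add_nonneg_nonneg)
    qed
    finally show ?thesis by (simp add: mult_ac del: of_nat_Suc)
  qed (simp add: kernel_neg)
  have "(\<Sum>J\<in>{s..a}. \<Sum>a'\<in>{a - 1, a}. \<Sum>b'\<in>{c - 1, c}.
     qp (a' - J + c) * (qp (J * int m) * g * kernel m (a' - J) (b' - J)))
    = (\<Sum>J\<in>{s..a}. \<Sum>a'\<in>{a - 1, a}. \<Sum>b'\<in>{c - 1, c}.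
     g * (qp (J * int (Suc m)) * (qp (c - J) * (qp (a' - J) * kernel m (a' - J) (b' - J)))))"
    using s by (intro sum.cong refl term_eq) auto
  also have "\<dots> = (\<Sum>J\<in>{s..a}. g * (qp (J * int (Suc m)) * nest m (a - J) (c - J)))"
  proof (intro sum.cong refl)
    fix J
    have "a - 1 - J = a - J - 1" "c - 1 - J = c - J - 1" by simp_all
    then show "(\<Sum>a'\<in>{a - 1, a}. \<Sum>b'\<in>{c - 1, c}.
       g * (qp (J * int (Suc m)) * (qp (c - J) * (qp (a' - J) * kernel m (a' - J) (b' - J)))))
       = g * (qp (J * int (Suc m)) * nest m (a - J) (c - J))"
      by (simp add: nest_def algebra_simps del: of_nat_Suc)
  qed
  also have "\<dots> = g * (qp (s * int (Suc m)) * kernel (Suc m) (a - s) (c - s))"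
    unfolding sum_distrib_left[symmetric] sum_nest[OF s] ..
  finally show ?thesis by (simp add: mult_ac)
qed

lemma config_gf_Nil: "config_gf [] s a b = (if a = b \<and> s \<le> a then 1 else 0)"
proof -
  have "configs [] s a b = (if a = b \<and> s \<le> a then {[]} else {})"
    unfolding configs_def by (auto simp: chordal_def elim: walk.elims)
  then show ?thesis by (simp add: config_gf_def)
qed

text \<open>Lowering all columns and labels by \<open>s\<close> lowers the weight by 2 n s - n s = n
  s, hence the power of q and the shifted arguments. The scalar from \<open>kernel_comp\<close> is
  exactly the one in \<open>tree_gf_arch\<close>.\<close>

lemma config_gf_eq:
  assumes "dyck w n" "0 \<le> s"
  shows "config_gf w s a b = qp (s * int n) * tree_gf w * kernel n (a - s) (b - s)"
  using assms
proof (induction arbitrary: s a b rule: dyck_induct)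
  case Nil
  then show ?case by (auto simp: config_gf_Nil kernel_0)
next
  case (arch u m v k)
  note s = \<open>0 \<le> s\<close>
  define B where "B = a + int (2 * (m + 1))"
  have "config_gf (arch u v) s a b = (\<Sum>c\<in>{s..B}.
     (qp (s * int (Suc m)) * tree_gf u * kernel (Suc m) (a - s) (c - s))
     * (qp (s * int k) * tree_gf v * kernel k (c - s) (b - s)))"
    (is "_ = sum ?g _")
    unfolding config_gf_arch[OF arch.hyps(1,2) s order_refl[of B, unfolded B_def], folded B_def]
  proof (intro sum.cong refl arg_cong2[where f = "(*)"])
    fix c
    have "(\<Sum>J\<in>{s..a}. \<Sum>a'\<in>{a - 1, a}. \<Sum>b'\<in>{c - 1, c}. qp (a' - J + c) * config_gf u J a' b')
     = (\<Sum>J\<in>{s..a}. \<Sum>a'\<in>{a - 1, a}. \<Sum>b'\<in>{c - 1, c}.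
       qp (a' - J + c) * (qp (J * int m) * tree_gf u * kernel m (a' - J) (b' - J)))"
      using s by (intro sum.cong refl) (simp add: arch.IH(1))
    then show "(\<Sum>J\<in>{s..a}. \<Sum>a'\<in>{a - 1, a}. \<Sum>b'\<in>{c - 1, c}. qp (a' - J + c) * config_gf u J a' b')
      = qp (s * int (Suc m)) * tree_gf u * kernel (Suc m) (a - s) (c - s)"
      unfolding sum_enclosed[OF s] .
  qed (rule arch.IH(2)[OF s])
  also have "\<dots> = qp (s * int (Suc m)) * qp (s * int k) * tree_gf u * tree_gf v *
      (\<Sum>c\<in>{s..B}. kernel (Suc m) (a - s) (c - s) * kernel k (c - s) (b - s))"
    unfolding sum_distrib_left by (intro sum.cong refl) (simp only: mult_ac)
  also have "(\<Sum>c\<in>{s..B}. kernel (Suc m) (a - s) (c - s) * kernel k (c - s) (b - s))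
     = (\<Sum>c\<in>{0..B - s}. kernel (Suc m) (a - s) c * kernel k c (b - s))"
    by (rule sum.reindex_bij_witness[of _ "\<lambda>c. c + s" "\<lambda>c. c - s"]) auto
  also have "\<dots> = qbin (Suc m) k * kernel (Suc m + k) (a - s) (b - s)"
  proof (cases "s \<le> a")
    case True
    then show ?thesis by (intro kernel_comp) (auto simp: B_def)
  qed (simp add: kernel_neg)
  also have "qp (s * int (Suc m)) * qp (s * int k) = qp (s * int (Suc (m + k)))"
    using s by (subst qp_add[symmetric]) (auto simp: algebra_simps)
  finally show ?case unfolding tree_gf_arch[OF arch.hyps(1,2)] by (simp add: mult_ac)
qed

section \<open>Tilings as configurations\<close>

lemma ht_le: "ht w x \<le> int x"
proof (induction x)
  case (Suc x)
  then show ?case by (cases "x < length w") (auto simp: ht_Suc ht_ge_length[of w "Suc x"] ht_ge_length[of w x])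
qed simp

lemma ht_parity: "x \<le> length w \<Longrightarrow> even (ht w x - int x)"
  by (induction x) (auto simp: ht_Suc)

lemma ht_dyck_le:
  assumes "dyck w n" "x \<le> 2 * n"
  shows "ht w x \<le> 2 * int n - int x"
proof -
  have "ht w x \<le> ht w (x + d) + int d" for d
  proof (induction d)
    case (Suc d)
    then show ?case
      by (cases "x + d < length w") (auto simp: ht_Suc ht_ge_length[of w "Suc (x + d)"] ht_ge_length[of w "x + d"])
  qed simp
  from this[of "2 * n - x"] show ?thesis using assms(2) dyck_ht_end[OF assms(1)] by simp
qed

lemma chord_at:
  assumes "dyck w n" "x < 2 * n"
  obtains y where "w ! x" "(x, y) \<in> chords w" | y where "\<not> w ! x" "(y, x) \<in> chords w"
proof -
  have "\<exists>c\<in>chords w. (if w ! x then fst c = x else snd c = x)"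
    using assms
  proof (induction arbitrary: x rule: dyck_induct)
    case (arch u m v k)
    note chords = chords_arch[OF arch.hyps]
    show ?case
    proof (cases rule: arch_cases[where i = x and m = m])
      case 1
      then show ?thesis using chords by (auto simp: arch_def)
    next
      case (2 y)
      from arch.IH(1)[OF 2(2)] obtain c where "c \<in> chords u" "if u ! y then fst c = y else snd c = y" ..
      then show ?thesis using 2 nth_arch_inner[OF arch.hyps(1), of y v] chords
        by (intro bexI[of _ "shift 1 c"]) auto
    next
      case 3
      then show ?thesis using nth_arch_close[OF arch.hyps(1)] chords by auto
    next
      case (4 y)
      then have "y < 2 * k" using arch.prems by simp
      from arch.IH(2)[OF this] obtain c where "c \<in> chords v" "if v ! y then fst c = y else snd c = y" ..
      then show ?thesis using 4 nth_arch_right[OF arch.hyps(1), of v y] chords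
        by (intro bexI[of _ "shift (2 * m + 2) c"]) auto
    qed
  qed simp
  then show ?thesis using that by (metis prod.collapse)
qed

lemma sum_steps_eq_sum_chords:
  fixes f :: "nat \<Rightarrow> int"
  assumes "dyck w n"
  shows "(\<Sum>x<2 * n. f x) = (\<Sum>c\<in>chords w. f (fst c) + f (snd c))"
  using assms
proof (induction arbitrary: f rule: dyck_induct)
  case (arch u m v k)
  have inj: "inj_on (shift d) A" for A d by (rule inj_on_subset[OF inj_shift]) simp
  note dist = chords_arch_distinct[OF arch.hyps(1)] chords_arch_distinct[OF arch.hyps(1), symmetric]
  have "(\<Sum>c\<in>chords (arch u v). f (fst c) + f (snd c)) = f 0 + f (Suc (2 * m))
      + ((\<Sum>c\<in>shift 1 ` chords u. f (fst c) + f (snd c))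
        + (\<Sum>c\<in>shift (2 * m + 2) ` chords v. f (fst c) + f (snd c)))"
    unfolding chords_arch[OF arch.hyps]
    by (subst sum.insert; (subst sum.union_disjoint)?)
      (auto simp: dist finite_chords simp del: One_nat_def add_2_eq_Suc')
  also have "\<dots> = f 0 + f (Suc (2 * m)) + ((\<Sum>x<2 * m. f (Suc x)) + (\<Sum>x<2 * k. f (x + (2 * m + 2))))"
    unfolding sum.reindex[OF inj] arch.IH by simp
  also have "(\<Sum>x<2 * k. f (x + (2 * m + 2))) = (\<Sum>x=2*m+2..<2*m+2+2*k. f x)"
    by (rule sum.reindex_bij_witness[of _ "\<lambda>x. x - (2 * m + 2)" "\<lambda>x. x + (2 * m + 2)"]) auto
  also have "f 0 + f (Suc (2 * m)) + ((\<Sum>x<2 * m. f (Suc x)) + (\<Sum>x=2*m+2..<2*m+2+2*k. f x))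
     = (\<Sum>x<2 * m + 2. f x) + (\<Sum>x=2*m+2..<2*m+2+2*k. f x)"
    using sum.lessThan_Suc_shift[of f "2 * m"] by simp
  also have "\<dots> = (\<Sum>x<2 * Suc (m + k). f x)"
    using sum.atLeastLessThan_concat[of 0 "2 * m + 2" "2 * m + 2 + 2 * k" f]
    by (simp add: lessThan_atLeast0 distrib_left add.assoc add.commute)
  finally show ?case ..
qed simp

text \<open>The list stores the column after each step, so position x reads entry x - 1 and position
  0 the start value.\<close>

definition col_height :: "int \<Rightarrow> (int \<times> int) list \<Rightarrow> nat \<Rightarrow> int" where
  "col_height a xs x = (if x = 0 then a else snd (xs ! (x - 1)))"

lemma walk_iff:
  "walk w s a b xs \<longleftrightarrow> length xs = length w \<and> s \<le> a \<and> col_height a xs (length w) = b \<and>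
     (\<forall>x<length w. s \<le> fst (xs ! x) \<and> fst (xs ! x) \<le> col_height a xs x \<and> fst (xs ! x) \<le> col_height a xs (Suc x) \<and>
       (if w ! x then col_height a xs (Suc x) \<le> col_height a xs x \<and> col_height a xs x \<le> col_height a xs (Suc x) + 1
        else col_height a xs x \<le> col_height a xs (Suc x) \<and> col_height a xs (Suc x) \<le> col_height a xs x + 1))"
proof (induction w s a b xs rule: walk.induct)
  case (2 c w s a b j l xs)
  have tail: "col_height a ((j, l) # xs) (Suc x) = col_height l xs x" for x
    by (simp add: col_height_def)
  have head: "col_height a' xs' 0 = a'" for a' xs'
    by (simp add: col_height_def)
  show ?case
    unfolding tail head walk.simps 2 length_Cons All_less_Suc2 nat.inject nth_Cons_0 nth_Cons_Suc fst_conv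
    by (intro iffI; elim conjE; intro conjI; (assumption | (rule order_trans, assumption, assumption)))
qed (auto simp: col_height_def)

section \<open>From configurations to tilings\<close>

locale dyck_path =
  fixes lam :: "bool list" and n :: nat
  assumes dyck: "dyck lam n"
begin

text \<open>Levels are counted from \<open>lam\<close>: a box of level 0 has its bottom vertex on
  the path, and a shift down by 2 lowers the level by one.\<close>

definition cell :: "nat \<Rightarrow> int \<Rightarrow> box" where
  "cell x k = (int x, ht lam x + 1 + 2 * k)"

text \<open>Symmetric in x and y and vacuous for x = y, hence an equivalence for fixed k; its
  classes are the maximal runs that become tiles.\<close>

definition linked :: "(nat \<Rightarrow> int) \<Rightarrow> int \<Rightarrow> nat \<Rightarrow> nat \<Rightarrow> bool" where
  "linked j k x y \<longleftrightarrow> (\<forall>z. min x y \<le> z \<and> z < max x y \<longrightarrow> k < j z)"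

definition tile :: "(nat \<Rightarrow> int) \<Rightarrow> int \<Rightarrow> nat \<Rightarrow> box set" where
  "tile j k x = (\<lambda>y. cell y k) ` {y. y \<le> 2 * n \<and> linked j k x y}"

definition tiles :: "(nat \<Rightarrow> int) \<Rightarrow> (nat \<Rightarrow> int) \<Rightarrow> box set set" where
  "tiles m j = {tile j k x |x k. x \<le> 2 * n \<and> 0 \<le> k \<and> k < m x}"

definition valid :: "(nat \<Rightarrow> int) \<Rightarrow> (nat \<Rightarrow> int) \<Rightarrow> bool" where
  "valid m j \<longleftrightarrow> m 0 = 0 \<and> m (2 * n) = 0 \<and>
     (\<forall>x<2 * n. 0 \<le> j x \<and> j x \<le> m x \<and> j x \<le> m (Suc x) \<and>
        (if lam ! x then m (Suc x) \<le> m x \<and> m x \<le> m (Suc x) + 1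
         else m x \<le> m (Suc x) \<and> m (Suc x) \<le> m x + 1)) \<and>
     (\<forall>c\<in>chords lam. j (fst c) = j (snd c) \<and> (\<forall>x. fst c < x \<and> x < snd c \<longrightarrow> j (fst c) \<le> j x))"

lemma len: "length lam = 2 * n"
  using dyck_length[OF dyck] .

lemma configs_iff_valid:
  "xs \<in> configs lam 0 0 0 \<longleftrightarrow> length xs = 2 * n \<and> valid (col_height 0 xs) (\<lambda>x. fst (xs ! x))"
  unfolding configs_def mem_Collect_eq walk_iff chordal_def valid_def len
  by (auto simp: col_height_def[of 0 xs 0])

lemma cell_eq_iff [simp]: "cell x k = cell y l \<longleftrightarrow> x = y \<and> k = l"
  by (auto simp: cell_def)

lemma cell_down: "(case cell x k of (a, b) \<Rightarrow> (a, b - 2)) = cell x (k - 1)"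
  by (simp add: cell_def)

lemma linked_refl [simp]: "linked j k x x"
  by (simp add: linked_def)

lemma linked_sym: "linked j k x y \<longleftrightarrow> linked j k y x"
  by (simp add: linked_def min.commute max.commute)

lemma linked_trans: "linked j k x y \<Longrightarrow> linked j k y z \<Longrightarrow> linked j k x z"
  unfolding linked_def by (smt (verit) max_def min_def nat_le_linear not_le order_trans)

lemma linked_le: "x \<le> y \<Longrightarrow> linked j k x y \<longleftrightarrow> (\<forall>z. x \<le> z \<and> z < y \<longrightarrow> k < j z)"
  by (simp add: linked_def min_absorb1 max_absorb2)

lemma linked_Suc: "linked j k x (Suc x) \<longleftrightarrow> k < j x"
  by (auto simp: linked_le less_Suc_eq_le)

lemma linked_pred: "linked j k x y \<Longrightarrow> linked j (k - 1) x y"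
  unfolding linked_def by force

lemma linked_between:
  assumes "linked j k x y" "min x y \<le> z" "z \<le> max x y"
  shows "linked j k x z"
  using assms unfolding linked_def by (auto simp: min_def max_def split: if_splits)

lemma cell_in_tile: "cell y l \<in> tile j k x \<longleftrightarrow> l = k \<and> y \<le> 2 * n \<and> linked j k x y"
  unfolding tile_def by auto

lemma tile_cong: "linked j k x y \<Longrightarrow> tile j k x = tile j k y"
  unfolding tile_def using linked_trans linked_sym by blast

lemma valid_m_nonneg: "valid m j \<Longrightarrow> x \<le> 2 * n \<Longrightarrow> 0 \<le> m x"
  unfolding valid_def by (metis le_neq_implies_less order_refl order_trans)

lemma valid_j:
  assumes "valid m j" "x < 2 * n"
  shows "0 \<le> j x" "j x \<le> m x" "j x \<le> m (Suc x)"
  using assms unfolding valid_def by blast+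

text \<open>A maximal run of positions linked at level \<open>k\<close> cannot descend below its left end: the chord
  closed by the first such down step starts to the left of the run, and its label would extend the run.\<close>
lemma run_interval:
  assumes val: "valid m j" and x: "x \<le> 2 * n"
  obtains c d where "c \<le> x" "x \<le> d" "d \<le> 2 * n"
    "{y. y \<le> 2 * n \<and> linked j k x y} = {c..d}" "ht lam c = ht lam d"
    "\<forall>y\<in>{c..d}. ht lam c \<le> ht lam y"
    "\<forall>z\<in>{c..<d}. k < j z" "c = 0 \<or> j (c - 1) \<le> k"
proof -
  define R where "R = {y. y \<le> 2 * n \<and> linked j k x y}"
  have finR: "finite R" and xR: "x \<in> R" using x by (auto simp: R_def)
  define c where "c = Min R"
  define d where "d = Max R"
  have cR: "c \<in> R" and dR: "d \<in> R" using finR xR Min_in Max_in unfolding c_def d_def by blast+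
  have cx: "c \<le> x" and xd: "x \<le> d" using finR xR unfolding c_def d_def by simp_all
  have Rcd: "R = {c..d}"
  proof (intro set_eqI iffI)
    fix y assume "y \<in> R" then show "y \<in> {c..d}" using finR unfolding c_def d_def by simp
  next
    fix y assume y: "y \<in> {c..d}"
    have "linked j k x y"
    proof (cases "y \<le> x")
      case True
      then have "min x c \<le> y" "y \<le> max x c" using y cx by auto
      moreover have "linked j k x c" using cR by (simp add: R_def)
      ultimately show ?thesis by (rule linked_between[rotated 1])
    next
      case False
      then have "min x d \<le> y" "y \<le> max x d" using y xd by auto
      moreover have "linked j k x d" using dR by (simp add: R_def)
      ultimately show ?thesis by (rule linked_between[rotated 1])
    qed
    then show "y \<in> R" using y dR by (auto simp: R_def)
  qed
  have cd: "linked j k c d" using cR dR linked_trans linked_sym unfolding R_def by blast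
  then have inner: "k < j z" if "c \<le> z" "z < d" for z using that linked_le[of c d] cx xd by auto
  have d2n: "d \<le> 2 * n" using dR by (simp add: R_def)
  have left: "j (c - 1) \<le> k" if "0 < c"
  proof (rule ccontr)
    assume "\<not> j (c - 1) \<le> k"
    then have "linked j k (c - 1) c" using linked_Suc[of j k "c - 1"] that by simp
    moreover have "linked j k x c" using cR by (simp add: R_def)
    ultimately have "linked j k x (c - 1)" using linked_trans linked_sym by blast
    then have "c - 1 \<in> R" using cR by (auto simp: R_def)
    then show False using Rcd that by auto
  qed
  have right: "j d \<le> k" if "d < 2 * n"
  proof (rule ccontr)
    assume "\<not> j d \<le> k"
    then have "linked j k d (Suc d)" using linked_Suc[of j k d] by simp
    moreover have "linked j k x d" using dR by (simp add: R_def)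
    ultimately have "linked j k x (Suc d)" using linked_trans by blast
    then have "Suc d \<in> R" using that by (simp add: R_def)
    then show False using Rcd by auto
  qed
  have chord: "j (fst e) = j (snd e)" "\<And>z. fst e < z \<Longrightarrow> z < snd e \<Longrightarrow> j (fst e) \<le> j z" if "e \<in> chords lam" for e
    using val that unfolding valid_def by blast+
  have above_c: "ht lam c \<le> ht lam y" if "c \<le> y" "y \<le> d" for y
  proof (rule ccontr)
    assume "\<not> ht lam c \<le> ht lam y"
    then have ex: "\<exists>y. c \<le> y \<and> y \<le> d \<and> ht lam y < ht lam c" using that by force
    define y where "y = (LEAST y. c \<le> y \<and> y \<le> d \<and> ht lam y < ht lam c)"
    have y: "c \<le> y" "y \<le> d" "ht lam y < ht lam c" unfolding y_def using LeastI_ex[OF ex] by auto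
    have before: "ht lam c \<le> ht lam z" if "c \<le> z" "z < y" for z
      using not_less_Least[of z "\<lambda>y. c \<le> y \<and> y \<le> d \<and> ht lam y < ht lam c"] that y(2) unfolding y_def[symmetric]
      by fastforce
    have "c \<noteq> y" using y(3) by auto
    then obtain p where p: "y = Suc p" "c \<le> p" using y(1) by (cases y) auto
    have p2n: "p < 2 * n" using p y(2) d2n by simp
    have hp: "ht lam c \<le> ht lam p" using before p by simp
    have "\<not> lam ! p" "ht lam y = ht lam c - 1"
      using y(3) hp ht_Suc[of p lam] p p2n len by (auto split: if_splits)
    then obtain i where i: "(i, p) \<in> chords lam"
      using chord_at[OF dyck p2n] by blast
    have "ht lam i = ht lam y" "i < p" using chords_D[OF i] p by auto
    then have "i < c" using before[of i] y(3) p by force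
    have "k < j p" using inner p y(2) by simp
    then have "k < j i" using chord(1)[OF i] by simp
    moreover have "c - 1 \<noteq> i \<longrightarrow> i < c - 1 \<and> c - 1 < p" using \<open>i < c\<close> p(2) by linarith
    ultimately have "k < j (c - 1)" using chord(2)[OF i, of "c - 1"] by (cases "c - 1 = i") auto
    then show False using left \<open>i < c\<close> by simp
  qed
  \<comment> \<open>For the right end, the last position below it starts an up step whose chord
    closes at or beyond \<open>d\<close>, so its label would extend the run to the right.\<close>
  have above_d: "ht lam d \<le> ht lam y" if "c \<le> y" "y \<le> d" for y
  proof (rule ccontr)
    assume "\<not> ht lam d \<le> ht lam y"
    define S where "S = {y. c \<le> y \<and> y \<le> d \<and> ht lam y < ht lam d}"
    have S: "finite S" "S \<noteq> {}" using that \<open>\<not> ht lam d \<le> ht lam y\<close> by (auto simp: S_def)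
    define p where "p = Max S"
    have p: "c \<le> p" "p \<le> d" "ht lam p < ht lam d" using Max_in[OF S] unfolding p_def S_def by auto
    have after: "ht lam d \<le> ht lam z" if "p < z" "z \<le> d" for z
      using Max_ge[OF S(1), of z] that p(1) unfolding p_def[symmetric] by (force simp: S_def)
    have pd: "p < d" using p by (cases "p = d") auto
    then have p2n: "p < 2 * n" using d2n by simp
    have "lam ! p" "ht lam (Suc p) = ht lam d"
      using p(3) pd after[of "Suc p"] ht_Suc[of p lam] p2n len by (auto split: if_splits)
    then obtain i where i: "(p, i) \<in> chords lam"
      using chord_at[OF dyck p2n] by blast
    have "ht lam (Suc i) = ht lam p" "p < i" "i < 2 * n" using chords_D[OF i] len by auto
    then have "d \<le> i" using after[of "Suc i"] p(3) by force
    have "k < j p" using inner p(1) pd by simp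
    then have "k < j d" using chord[OF i] \<open>d \<le> i\<close> pd by (cases "d = i") fastforce+
    then show False using right \<open>d \<le> i\<close> \<open>i < 2 * n\<close> by simp
  qed
  have "ht lam c = ht lam d" using above_c[of d] above_d[of c] cx xd by simp
  then show ?thesis using that[OF cx xd d2n Rcd[unfolded R_def]] above_c inner left by auto
qed

lemma dyck_tile_run:
  assumes "c \<le> d" "d \<le> 2 * n" "ht lam c = ht lam d" "\<forall>y\<in>{c..d}. ht lam c \<le> ht lam y"
  shows "dyck_tile ((\<lambda>y. cell y k) ` {c..d})"
proof -
  let ?cs = "map (\<lambda>y. cell y k) [c..<Suc d]"
  have "?cs \<noteq> []" "set ?cs = (\<lambda>y. cell y k) ` {c..d}" using assms(1) by auto
  moreover have "fst (?cs ! Suc i) = fst (?cs ! i) + 1 \<and> \<bar>snd (?cs ! Suc i) - snd (?cs ! i)\<bar> = 1"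
    if "Suc i < length ?cs" for i
    using that assms(2) ht_Suc[of "c + i" lam] len by (simp add: cell_def nth_append del: upt_Suc)
  moreover have "hd ?cs = cell c k" "last ?cs = cell d k"
    using assms(1) by (simp_all add: hd_map last_map del: upt_Suc)
  ultimately show ?thesis unfolding dyck_tile_def
    using assms(3,4) by (intro exI[of _ ?cs]) (auto simp: cell_def simp del: upt_Suc)
qed

text \<open>A link at level k crosses a step with label above k, and that label bounds the columns
  at both ends of the step.\<close>

lemma linked_height:
  assumes "valid m j" "linked j k x y" "y \<le> 2 * n" "x \<le> 2 * n" "k < m x"
  shows "k < m y"
proof (cases x y rule: linorder_cases)
  case less
  then obtain z where z: "y = Suc z" "x \<le> z" by (cases y) auto
  then have "k < j z" using assms(2) linked_le[of x y] by simp
  then show ?thesis using valid_j[OF assms(1), of z] z assms(2-) by simp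
next
  case greater
  then have "k < j y" using assms(2) linked_le[of y x j k] linked_sym by simp
  then show ?thesis using valid_j[OF assms(1), of y] greater assms(2-) by simp
qed (use assms in simp)

lemma Union_tiles:
  assumes "valid m j"
  shows "\<Union>(tiles m j) = {cell x k |x k. x \<le> 2 * n \<and> 0 \<le> k \<and> k < m x}"
proof (intro set_eqI iffI)
  fix p assume "p \<in> \<Union>(tiles m j)"
  then obtain x k where x: "p \<in> tile j k x" "x \<le> 2 * n" "0 \<le> k" "k < m x"
    by (auto simp: tiles_def)
  then obtain y where "p = cell y k" "y \<le> 2 * n" "linked j k x y" by (auto simp: tile_def)
  then show "p \<in> {cell x k |x k. x \<le> 2 * n \<and> 0 \<le> k \<and> k < m x}" using linked_height[OF assms] x by blast
next
  fix p assume "p \<in> {cell x k |x k. x \<le> 2 * n \<and> 0 \<le> k \<and> k < m x}"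
  then obtain x k where x: "p = cell x k" "x \<le> 2 * n" "0 \<le> k" "k < m x" by blast
  then have "p \<in> tile j k x" by (simp add: cell_in_tile)
  moreover have "tile j k x \<in> tiles m j" using x unfolding tiles_def by blast
  ultimately show "p \<in> \<Union>(tiles m j)" by blast
qed

text \<open>The outer bounds in \<open>Y\<close> hold for every box below \<open>mu\<close>, since a
  Dyck path stays under both diagonals; membership is thus decided by the two heights alone.\<close>

lemma skew_eq:
  assumes "dyck mu n" "\<And>x. x \<le> 2 * n \<Longrightarrow> ht mu x = ht lam x + 2 * m x"
  shows "skew lam mu n = {cell x k |x k. x \<le> 2 * n \<and> 0 \<le> k \<and> k < m x}"
proof (intro set_eqI iffI)
  fix p assume p: "p \<in> skew lam mu n"
  obtain a b where ab: "p = (a, b)" by (cases p)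
  define x where "x = nat a"
  have Y: "odd (a + b)" "a = int x" "x \<le> 2 * n" "ht lam x \<le> b - 1" "\<not> ht mu x \<le> b - 1"
    using p unfolding ab skew_def Y_def x_def by auto
  have "even (b - 1 - ht lam x)" using ht_parity[of x lam] Y(1-3) len by auto
  then obtain k where "b - 1 - ht lam x = 2 * k" by (elim evenE)
  then have "p = cell x k" "0 \<le> k" "k < m x" using Y assms(2)[OF Y(3)] by (auto simp: ab cell_def)
  then show "p \<in> {cell x k |x k. x \<le> 2 * n \<and> 0 \<le> k \<and> k < m x}" using Y(3) by blast
next
  fix p assume "p \<in> {cell x k |x k. x \<le> 2 * n \<and> 0 \<le> k \<and> k < m x}"
  then obtain x k where x: "p = cell x k" "x \<le> 2 * n" "0 \<le> k" "k < m x" by blast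
  have "ht mu x \<le> int x" "ht mu x \<le> 2 * int n - int x" using ht_le ht_dyck_le[OF assms(1) x(2)] by auto
  then show "p \<in> skew lam mu n"
    using x assms(2)[OF x(2)] ht_parity[of x lam] len
    unfolding skew_def Y_def cell_def by auto
qed

text \<open>Forced by ht mu = ht lam + 2 m: a step of \<open>lam\<close> is reversed exactly where
  \<open>m\<close> changes.\<close>

definition upper :: "(nat \<Rightarrow> int) \<Rightarrow> bool list" where
  "upper m = map (\<lambda>x. if lam ! x then m x = m (Suc x) else m x < m (Suc x)) [0..<2 * n]"

lemma ht_upper:
  assumes "valid m j" "x \<le> 2 * n"
  shows "ht (upper m) x = ht lam x + 2 * m x"
  using assms(2)
proof (induction x)
  case 0
  then show ?case using assms(1) by (simp add: valid_def)
next
  case (Suc x)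
  have "if lam ! x then m (Suc x) \<le> m x \<and> m x \<le> m (Suc x) + 1
         else m x \<le> m (Suc x) \<and> m (Suc x) \<le> m x + 1"
    using assms(1) Suc.prems unfolding valid_def by simp
  then show ?case using Suc ht_Suc[of x lam] ht_Suc[of x "upper m"] len
    by (auto simp: upper_def split: if_splits)
qed

lemma dyck_upper:
  assumes "valid m j" shows "dyck (upper m) n"
  unfolding dyck_def
  using ht_upper[OF assms] valid_m_nonneg[OF assms] dyck_ht_nonneg[OF dyck] dyck_ht_end[OF dyck] assms
  by (auto simp: upper_def valid_def)

lemma tiles_in_tilings_star:
  assumes val: "valid m j"
  shows "(upper m, tiles m j) \<in> tilings_star lam n"
proof -
  have "weakly_above (upper m) lam"
    unfolding weakly_above_def using ht_upper[OF val] valid_m_nonneg[OF val] len by simp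
  moreover have "dyck_tiling lam (upper m) n (tiles m j)"
    unfolding dyck_tiling_def
  proof (intro conjI ballI impI)
    show "\<Union>(tiles m j) = skew lam (upper m) n"
      using Union_tiles[OF val] skew_eq[OF dyck_upper[OF val] ht_upper[OF val]] by simp
  next
    fix T assume "T \<in> tiles m j"
    then obtain x k where T: "T = tile j k x" "x \<le> 2 * n" by (auto simp: tiles_def)
    obtain c d where "c \<le> x" "x \<le> d" "d \<le> 2 * n"
      "{y. y \<le> 2 * n \<and> linked j k x y} = {c..d}" "ht lam c = ht lam d"
      "\<forall>y\<in>{c..d}. ht lam c \<le> ht lam y"
      "\<forall>z\<in>{c..<d}. k < j z" "c = 0 \<or> j (c - 1) \<le> k"
      by (rule run_interval[OF val T(2), where k = k])
    then show "dyck_tile T" unfolding T(1) tile_def using dyck_tile_run[of c d k] by simp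
  next
    fix T T' assume "T \<in> tiles m j" "T' \<in> tiles m j" "T \<noteq> T'"
    then obtain x k x' k' where T: "T = tile j k x" "T' = tile j k' x'" by (auto simp: tiles_def)
    show "T \<inter> T' = {}"
    proof (rule ccontr)
      assume "T \<inter> T' \<noteq> {}"
      then obtain p where p: "p \<in> T" "p \<in> T'" by blast
      then obtain y where "p = cell y k" unfolding T(1) tile_def by blast
      with p have "cell y k \<in> T" "cell y k \<in> T'" by simp_all
      then have "k = k'" "linked j k x y" "linked j k' x' y" unfolding T by (auto simp: cell_in_tile)
      then show False using \<open>T \<noteq> T'\<close> tile_cong unfolding T by blast
    qed
  qed
  moreover have "cover_inclusive lam (tiles m j)"
    unfolding cover_inclusive_def
  proof
    fix T assume "T \<in> tiles m j"
    then obtain x k where T: "T = tile j k x" "x \<le> 2 * n" "0 \<le> k" "k < m x" by (auto simp: tiles_def)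
    show "(\<forall>(a, b)\<in>T. b - 1 \<le> ht lam (nat a)) \<or> (\<exists>T'\<in>tiles m j. (\<lambda>(a, b). (a, b - 2)) ` T \<subseteq> T')"
    proof (cases "k = 0")
      case True
      then show ?thesis by (auto simp: T(1) tile_def cell_def)
    next
      case False
      then have "tile j (k - 1) x \<in> tiles m j" using T unfolding tiles_def by force
      moreover have "(\<lambda>(a, b). (a, b - 2)) ` T \<subseteq> tile j (k - 1) x"
        unfolding T(1) using linked_pred by (auto simp: tile_def cell_down image_image)
      ultimately show ?thesis by blast
    qed
  qed
  ultimately show ?thesis using dyck_upper[OF val] by (simp add: tilings_star_def)
qed

text \<open>The label of a step can be read off from the tiles alone, which gives injectivity of the
  encoding.\<close>

lemma tiles_joined_iff:
  assumes "valid m j" "x < 2 * n"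
  shows "(\<exists>T\<in>tiles m j. cell x k \<in> T \<and> cell (Suc x) k \<in> T) \<longleftrightarrow> 0 \<le> k \<and> k < j x"
proof
  assume "\<exists>T\<in>tiles m j. cell x k \<in> T \<and> cell (Suc x) k \<in> T"
  then obtain y l where "0 \<le> l" "cell x k \<in> tile j l y" "cell (Suc x) k \<in> tile j l y"
    by (auto simp: tiles_def)
  then have "0 \<le> k" "linked j k x (Suc x)" using linked_trans linked_sym unfolding cell_in_tile by blast+
  then show "0 \<le> k \<and> k < j x" by (simp add: linked_Suc)
next
  assume k: "0 \<le> k \<and> k < j x"
  have "j x \<le> m x" using assms unfolding valid_def by blast
  then have "tile j k x \<in> tiles m j" using k assms(2) unfolding tiles_def by force
  then show "\<exists>T\<in>tiles m j. cell x k \<in> T \<and> cell (Suc x) k \<in> T"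
    using k assms(2) by (intro bexI) (auto simp: cell_in_tile linked_Suc)
qed

end

lemma weight_eq_sum:
  "length xs = length w \<Longrightarrow>
   weight w xs = (\<Sum>x<length w. snd (xs ! x) - (if w ! x then fst (xs ! x) else 0))"
proof (induction w arbitrary: xs)
  case (Cons c w)
  then obtain j l ys where "xs = (j, l) # ys" by (metis Suc_length_conv surj_pair)
  then show ?case using Cons by (simp add: sum.lessThan_Suc_shift del: sum.lessThan_Suc cong: if_cong)
qed simp

text \<open>Turns a count of levels into a threshold for them.\<close>

lemma mem_initial_segment_iff:
  fixes S :: "int set"
  assumes S: "S \<subseteq> {0..<M}" and down: "\<And>k. k \<in> S \<Longrightarrow> 0 < k \<Longrightarrow> k - 1 \<in> S"
  shows "k \<in> S \<longleftrightarrow> 0 \<le> k \<and> k < int (card S)"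
proof (cases "S = {}")
  case False
  have fin: "finite S" using S finite_subset by blast
  have below: "k - int l \<in> S" if "k \<in> S" "int l \<le> k" for k l
    using that(2)
  proof (induction l)
    case (Suc l)
    then show ?case using down[of "k - int l"] by (simp add: algebra_simps)
  qed (use that in simp)
  have S_eq: "S = {0..Max S}"
  proof (intro set_eqI iffI)
    fix x assume "x \<in> S" then show "x \<in> {0..Max S}" using S fin by auto
  next
    fix x assume "x \<in> {0..Max S}"
    then show "x \<in> S" using below[OF Max_in[OF fin False], of "nat (Max S - x)"] by simp
  qed
  then have "card S = nat (Max S + 1)" by (metis card_atLeastAtMost_int diff_zero)
  moreover have "0 \<le> Max S" using Max_in[OF fin False] S by auto
  ultimately show ?thesis using \<open>S = {0..Max S}\<close> by (metis atLeastAtMost_iff int_nat_eq zle_add1_eq_le add_increasing2 zero_le_one)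
qed simp

lemma path_eqI:
  assumes "length w = length w'" "\<And>x. x \<le> length w \<Longrightarrow> ht w x = ht w' x"
  shows "w = w'"
proof (rule nth_equalityI)
  fix x assume "x < length w"
  then show "w ! x = w' ! x"
    using assms(2)[of x] assms(2)[of "Suc x"] assms(1) ht_Suc[of x w] ht_Suc[of x w']
    by (auto split: if_splits)
qed (rule assms(1))

context dyck_path
begin

text \<open>Each tile is counted at its left end. At position x the levels below
  \<open>j (x - 1)\<close> continue a tile from the left and the remaining levels below
  \<open>m x\<close> start one; nothing precedes position 0, so \<open>low 0 = 0\<close>.\<close>

lemma card_tiles:
  assumes val: "valid m j"
  shows "int (card (tiles m j)) = (\<Sum>x\<le>2 * n. m x) - (\<Sum>x<2 * n. j x)"
proof -
  define low where "low x = (if x = 0 then 0 else j (x - 1))" for x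
  define S where "S = (SIGMA x:{..2 * n}. {low x..<m x})"
  have low: "0 \<le> low x" "low x \<le> m x" if "x \<le> 2 * n" for x
    using valid_j[OF val, of "x - 1"] valid_m_nonneg[OF val that] that by (auto simp: low_def)
  have "bij_betw (\<lambda>(x, k). tile j k x) S (tiles m j)"
    unfolding bij_betw_def
  proof (intro conjI inj_onI set_eqI iffI)
    fix p q assume pq: "p \<in> S" "q \<in> S" "(\<lambda>(x, k). tile j k x) p = (\<lambda>(x, k). tile j k x) q"
    obtain x k y l where p: "p = (x, k)" and q: "q = (y, l)" by fastforce
    have S: "x \<le> 2 * n" "low x \<le> k" "y \<le> 2 * n" "low y \<le> l" and eq: "tile j k x = tile j l y"
      using pq unfolding p q S_def by auto
    have "cell x k \<in> tile j l y" using S(1) unfolding eq[symmetric] by (simp add: cell_in_tile)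
    then have kl: "k = l" and link: "linked j k y x" by (auto simp: cell_in_tile)
    have "x = y"
    proof (cases x y rule: linorder_cases)
      case less
      then have "k < j (y - 1)" using link linked_le[of x y j k] linked_sym by auto
      then show ?thesis using less S(4) kl by (simp add: low_def)
    next
      case greater
      then have "k < j (x - 1)" using link linked_le[of y x j k] by auto
      then show ?thesis using greater S(2) by (simp add: low_def)
    qed
    then show "p = q" using p q kl by simp
  next
    fix T assume "T \<in> (\<lambda>(x, k). tile j k x) ` S"
    then obtain x k where "T = tile j k x" "x \<le> 2 * n" "low x \<le> k" "k < m x" by (auto simp: S_def)
    then show "T \<in> tiles m j" using low(1)[of x] unfolding tiles_def by force
  next
    fix T assume "T \<in> tiles m j"
    then obtain x k where T: "T = tile j k x" "x \<le> 2 * n" "0 \<le> k" "k < m x" by (auto simp: tiles_def)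
    obtain c d where cd: "c \<le> x" "x \<le> d" "d \<le> 2 * n"
      "{y. y \<le> 2 * n \<and> linked j k x y} = {c..d}" "ht lam c = ht lam d"
      "\<forall>y\<in>{c..d}. ht lam c \<le> ht lam y" "\<forall>z\<in>{c..<d}. k < j z" "c = 0 \<or> j (c - 1) \<le> k"
      by (rule run_interval[OF val T(2), where k = k])
    then have c: "linked j k x c" "c \<le> 2 * n" by auto
    then have "k < m c" using linked_height[OF val c T(2,4)] by simp
    then have "(c, k) \<in> S" using c(2) cd(8) T(3) by (auto simp: S_def low_def)
    moreover have "T = tile j k c" using tile_cong[OF c(1)] T(1) by simp
    ultimately show "T \<in> (\<lambda>(x, k). tile j k x) ` S" by force
  qed
  then have "card (tiles m j) = card S" by (simp add: bij_betw_same_card)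
  also have "int (card S) = (\<Sum>x\<le>2 * n. m x - low x)"
    unfolding S_def using low by simp
  also have "\<dots> = (\<Sum>x\<le>2 * n. m x) - (\<Sum>x\<le>2 * n. low x)"
    by (rule sum_subtractf)
  also have "(\<Sum>x\<le>2 * n. low x) = (\<Sum>x<2 * n. j x)"
    by (simp add: lessThan_Suc_atMost[symmetric] sum.lessThan_Suc_shift low_def del: sum.lessThan_Suc)
  finally show ?thesis .
qed

lemma sum_card_tiles:
  assumes val: "valid m j"
  shows "int (\<Sum>T\<in>tiles m j. card T) = (\<Sum>x\<le>2 * n. m x)"
proof -
  have tiling: "dyck_tiling lam (upper m) n (tiles m j)"
    using tiles_in_tilings_star[OF val] by (simp add: tilings_star_def)
  have "(\<Sum>T\<in>tiles m j. card T) = card (\<Union>(tiles m j))"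
    using tiling unfolding dyck_tiling_def
    by (intro card_Union_disjoint[symmetric]) (auto simp: pairwise_def disjnt_def dyck_tile_def)
  also have "\<Union>(tiles m j) = (\<lambda>(x, k). cell x k) ` (SIGMA x:{..2 * n}. {0..<m x})"
    unfolding Union_tiles[OF val] by (auto simp: image_iff Bex_def)
  also have "card \<dots> = card (SIGMA x:{..2 * n}. {0..<m x})"
    by (intro card_image) (auto simp: inj_on_def)
  finally show ?thesis using valid_m_nonneg[OF val] by simp
qed

text \<open>The number of tiles is the number of boxes less the labels of all steps, where each
  chord label occurs twice. In the sum with the number of boxes everything is even, and halving
  leaves each label once.\<close>

lemma art_tiles:
  assumes xs: "xs \<in> configs lam 0 0 0"
  defines "m \<equiv> col_height 0 xs" and "j \<equiv> \<lambda>x. fst (xs ! x)"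
  shows "int (art (tiles m j)) = weight lam xs"
proof -
  have l: "length xs = length lam" and val: "valid m j"
    using xs configs_iff_valid len unfolding m_def j_def by auto
  have ch: "j (snd c) = j (fst c)" if "c \<in> chords lam" for c
    using val that unfolding valid_def by auto
  have sum_m: "(\<Sum>x\<le>2 * n. m x) = (\<Sum>x<2 * n. m (Suc x))"
    using val by (simp add: lessThan_Suc_atMost[symmetric] sum.lessThan_Suc_shift valid_def del: sum.lessThan_Suc)
  have "(\<Sum>x<2 * n. if lam ! x then j x else 0) = (\<Sum>c\<in>chords lam. j (fst c))"
    unfolding sum_steps_eq_sum_chords[OF dyck] by (intro sum.cong) (auto simp: chords_def)
  moreover have "(\<Sum>x<2 * n. j x) = 2 * (\<Sum>c\<in>chords lam. j (fst c))"
    unfolding sum_steps_eq_sum_chords[OF dyck] sum_distrib_left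
    by (intro sum.cong) (auto simp: ch)
  moreover have "weight lam xs = (\<Sum>x<2 * n. m (Suc x)) - (\<Sum>x<2 * n. if lam ! x then j x else 0)"
    unfolding weight_eq_sum[OF l] sum_subtractf len by (simp add: m_def j_def col_height_def cong: if_cong)
  ultimately have "int ((\<Sum>T\<in>tiles m j. card T) + card (tiles m j)) = 2 * weight lam xs"
    using card_tiles[OF val] sum_card_tiles[OF val] sum_m by simp
  then have "int (art (tiles m j)) = 2 * weight lam xs div 2"
    unfolding art_def zdiv_int by simp
  then show ?thesis by simp
qed

text \<open>A list determines \<open>m\<close> and \<open>j\<close> only along the path, while both
  are total functions.\<close>

lemma tiles_cong:
  assumes "\<And>x. x \<le> 2 * n \<Longrightarrow> m x = m' x" "\<And>x. x < 2 * n \<Longrightarrow> j x = j' x"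
  shows "tiles m j = tiles m' j'"
proof -
  have "linked j k x y = linked j' k x y" if "x \<le> 2 * n" "y \<le> 2 * n" for k x y
  proof -
    have "z < 2 * n" if "z < max x y" for z using that \<open>x \<le> 2 * n\<close> \<open>y \<le> 2 * n\<close> by auto
    then show ?thesis using assms(2) unfolding linked_def by auto
  qed
  then have tile: "tile j k x = tile j' k x" if "x \<le> 2 * n" for k x
    using that unfolding tile_def by (intro image_cong Collect_cong) auto
  show ?thesis unfolding tiles_def
    by (intro Collect_cong ex_cong1) (auto simp: assms(1) tile)
qed

lemma valid_cong:
  assumes "\<And>x. x \<le> 2 * n \<Longrightarrow> m x = m' x" "\<And>x. x < 2 * n \<Longrightarrow> j x = j' x" "valid m j"
  shows "valid m' j'"
proof -
  have in_range: "fst c < 2 * n" "snd c < 2 * n" "x < snd c \<longrightarrow> x < 2 * n" if "c \<in> chords lam" for c x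
    using chords_D(1,2)[OF that] len by auto
  have eqs: "m x = m' x" "m (Suc x) = m' (Suc x)" "j x = j' x" if "x < 2 * n" for x
    using assms(1)[of x] assms(1)[of "Suc x"] assms(2)[of x] that by simp_all
  have v: "m 0 = 0" "m (2 * n) = 0"
    "\<forall>x<2 * n. 0 \<le> j x \<and> j x \<le> m x \<and> j x \<le> m (Suc x) \<and>
        (if lam ! x then m (Suc x) \<le> m x \<and> m x \<le> m (Suc x) + 1
         else m x \<le> m (Suc x) \<and> m (Suc x) \<le> m x + 1)"
    "\<forall>c\<in>chords lam. j (fst c) = j (snd c) \<and> (\<forall>x. fst c < x \<and> x < snd c \<longrightarrow> j (fst c) \<le> j x)"
    using assms(3) unfolding valid_def by blast+
  show ?thesis unfolding valid_def
  proof (intro conjI)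
    show "m' 0 = 0" "m' (2 * n) = 0" using v(1,2) assms(1)[of 0] assms(1)[of "2 * n"] by simp_all
    show "\<forall>x<2 * n. 0 \<le> j' x \<and> j' x \<le> m' x \<and> j' x \<le> m' (Suc x) \<and>
        (if lam ! x then m' (Suc x) \<le> m' x \<and> m' x \<le> m' (Suc x) + 1
         else m' x \<le> m' (Suc x) \<and> m' (Suc x) \<le> m' x + 1)"
      using v(3) by (simp add: eqs cong: if_cong)
    show "\<forall>c\<in>chords lam. j' (fst c) = j' (snd c) \<and> (\<forall>x. fst c < x \<and> x < snd c \<longrightarrow> j' (fst c) \<le> j' x)"
      using v(4) in_range eqs(3) by metis
  qed
qed

section \<open>From cover-inclusive tilings back to configurations\<close>

context
  fixes mu :: "bool list" and D :: "box set set"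
  assumes tiling: "(mu, D) \<in> tilings_star lam n"
begin

definition height_of :: "nat \<Rightarrow> int" where
  "height_of x = (ht mu x - ht lam x) div 2"

definition joined :: "nat \<Rightarrow> int \<Rightarrow> bool" where
  "joined x k \<longleftrightarrow> (\<exists>T\<in>D. cell x k \<in> T \<and> cell (Suc x) k \<in> T)"

text \<open>A cardinality makes sense before the joined levels are known to form an initial
  segment.\<close>

definition label_of :: "nat \<Rightarrow> int" where
  "label_of x = int (card {k. joined x k})"

lemma
  shows dyck_mu: "dyck mu n" and tile_D: "T \<in> D \<Longrightarrow> dyck_tile T"
    and disjoint_D: "T \<in> D \<Longrightarrow> T' \<in> D \<Longrightarrow> p \<in> T \<Longrightarrow> p \<in> T' \<Longrightarrow> T = T'"
    and Union_D: "\<Union>D = skew lam mu n"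
    and cover_D: "T \<in> D \<Longrightarrow> (\<forall>(a, b)\<in>T. b - 1 \<le> ht lam (nat a)) \<or>
      (\<exists>T'\<in>D. (\<lambda>(a, b). (a, b - 2)) ` T \<subseteq> T')"
proof -
  from tiling have mu: "dyck mu n" and D: "dyck_tiling lam mu n D" and cov: "cover_inclusive lam D"
    unfolding tilings_star_def by simp_all
  show "dyck mu n" by (rule mu)
  show "T \<in> D \<Longrightarrow> dyck_tile T" "\<Union>D = skew lam mu n"
    using D unfolding dyck_tiling_def by simp_all
  show "T \<in> D \<Longrightarrow> T' \<in> D \<Longrightarrow> p \<in> T \<Longrightarrow> p \<in> T' \<Longrightarrow> T = T'"
    using D unfolding dyck_tiling_def by fast
  show "T \<in> D \<Longrightarrow> (\<forall>(a, b)\<in>T. b - 1 \<le> ht lam (nat a)) \<or>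
      (\<exists>T'\<in>D. (\<lambda>(a, b). (a, b - 2)) ` T \<subseteq> T')"
    using cov unfolding cover_inclusive_def by (rule bspec)
qed

lemma ht_mu: 
  assumes "x \<le> 2 * n" shows "ht mu x = ht lam x + 2 * height_of x"
proof -
  have "even (ht mu x - int x)" "even (ht lam x - int x)"
    using ht_parity[of x mu] ht_parity[of x lam] assms len dyck_length[OF dyck_mu] by simp_all
  then have "even (ht mu x - ht lam x)" by (auto simp: even_diff_iff)
  then show ?thesis by (simp add: height_of_def)
qed

lemma height_of_nonneg: "x \<le> 2 * n \<Longrightarrow> 0 \<le> height_of x"
  using tiling len by (simp add: tilings_star_def weakly_above_def height_of_def pos_imp_zdiv_nonneg_iff)

lemma Union_D_cells: "\<Union>D = {cell x k |x k. x \<le> 2 * n \<and> 0 \<le> k \<and> k < height_of x}"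
  unfolding Union_D by (rule skew_eq[OF dyck_mu ht_mu])

lemma cell_D: "cell x k \<in> T \<Longrightarrow> T \<in> D \<Longrightarrow> x \<le> 2 * n \<and> 0 \<le> k \<and> k < height_of x"
proof -
  assume "cell x k \<in> T" "T \<in> D"
  then have "cell x k \<in> \<Union>D" by blast
  then show ?thesis unfolding Union_D_cells by auto
qed

text \<open>By cover-inclusiveness the boxes of a tile stay together when moved down one level. When
  one of them reaches level 0 no further descent is possible, so the whole tile rests on
  \<open>lam\<close> and has level 0 throughout.\<close>

lemma same_level:
  assumes "T \<in> D" "cell x k \<in> T" "cell y l \<in> T"
  shows "l = k"
proof -
  have "cell x (int K) \<in> T \<Longrightarrow> cell y l \<in> T \<Longrightarrow> T \<in> D \<Longrightarrow> l = int K" for K T l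
  proof (induction K arbitrary: T l rule: less_induct)
    case (less K)
    note pos = cell_D[OF less.prems(1,3)] cell_D[OF less.prems(2,3)]
    consider "\<forall>(a, b)\<in>T. b - 1 \<le> ht lam (nat a)"
      | T' where "T' \<in> D" "(\<lambda>(a, b). (a, b - 2)) ` T \<subseteq> T'"
      using cover_D[OF less.prems(3)] by blast
    then show ?case
    proof cases
      case 1
      then show ?thesis using bspec[OF 1 less.prems(1)] bspec[OF 1 less.prems(2)] pos by (simp add: cell_def)
    next
      case 2
      have down: "cell x (int K - 1) \<in> T'" "cell y (l - 1) \<in> T'"
        using 2(2) imageI[OF less.prems(1), of "\<lambda>(a, b). (a, b - 2)"]
          imageI[OF less.prems(2), of "\<lambda>(a, b). (a, b - 2)"] unfolding cell_down by blast+
      then have "0 < K" using cell_D[OF down(1) 2(1)] by simp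
      then have "int K - 1 = int (K - 1)" by simp
      then show ?thesis using less.IH[of "K - 1" T' "l - 1"] down 2(1) \<open>0 < K\<close> by simp
    qed
  qed
  from this[of "nat k" T l] show ?thesis using assms cell_D[OF assms(2,1)] by simp
qed

text \<open>At constant level the boxes copy the piece of \<open>lam\<close> beneath them, so the
  Dyck condition on the tile becomes a condition on that piece of path.\<close>

lemma tile_D_shape:
  assumes T: "T \<in> D"
  obtains k c d where "0 \<le> k" "c \<le> d" "d \<le> 2 * n" "T = (\<lambda>y. cell y k) ` {c..d}"
    "ht lam c = ht lam d" "\<forall>y\<in>{c..d}. ht lam c \<le> ht lam y"
proof -
  obtain cs where cs: "cs \<noteq> []" "set cs = T"
    "\<And>i. Suc i < length cs \<Longrightarrow> fst (cs ! Suc i) = fst (cs ! i) + 1"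
    "\<forall>p\<in>set cs. snd (hd cs) \<le> snd p" "snd (last cs) = snd (hd cs)"
    using tile_D[OF T] unfolding dyck_tile_def by blast
  have cell: "\<exists>x k. p = cell x k" if "p \<in> T" for p using that T Union_D_cells by blast
  have "cs ! 0 \<in> T" using cs(1,2) by auto
  then obtain c k where c: "cs ! 0 = cell c k" using cell by blast
  have nth: "cs ! i = cell (c + i) k" if "i < length cs" for i
    using that
  proof (induction i)
    case (Suc i)
    have "cs ! Suc i \<in> T" using Suc.prems cs(2) nth_mem by blast
    then obtain y l where y: "cs ! Suc i = cell y l" using cell by blast
    have "l = k" using same_level[OF T, of c k y l] c y \<open>cs ! 0 \<in> T\<close> \<open>cs ! Suc i \<in> T\<close> by simp
    moreover have "y = c + Suc i" using cs(3)[OF Suc.prems] Suc y by (simp add: cell_def)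
    ultimately show ?case using y by simp
  qed (simp add: c)
  define d where "d = c + (length cs - 1)"
  have last: "last cs = cell d k" using nth[of "length cs - 1"] cs(1) by (simp add: last_conv_nth d_def)
  have "T = (\<lambda>y. cell y k) ` {c..d}"
  proof (intro set_eqI iffI)
    fix p assume "p \<in> T"
    then obtain i where "i < length cs" "p = cs ! i" using cs(2) by (metis in_set_conv_nth)
    then show "p \<in> (\<lambda>y. cell y k) ` {c..d}" using nth[of i] by (auto simp: d_def)
  next
    fix p assume "p \<in> (\<lambda>y. cell y k) ` {c..d}"
    then obtain y where y: "p = cell y k" "c \<le> y" "y \<le> d" by auto
    moreover have "0 < length cs" using cs(1) by simp
    ultimately have l: "y - c < length cs" unfolding d_def by linarith
    then have "p = cs ! (y - c)" using nth[OF l] y by simp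
    with l show "p \<in> T" using cs(2) nth_mem by blast
  qed
  moreover have "c \<le> d" by (simp add: d_def)
  moreover have "d \<le> 2 * n" "0 \<le> k"
  proof -
    have "cell d k \<in> T" using last cs(1,2) last_in_set by metis
    then show "d \<le> 2 * n" "0 \<le> k" using cell_D T by blast+
  qed
  moreover have "hd cs = cell c k" using c cs(1) by (simp add: hd_conv_nth)
  ultimately show ?thesis using that[of k c d] cs(2,4,5) last by (auto simp: cell_def)
qed

lemma joined_bounds:
  assumes "joined x k" shows "0 \<le> k" "k < height_of x" "k < height_of (Suc x)" "x < 2 * n"
  using assms cell_D unfolding joined_def by (force simp: Suc_le_eq)+

lemma joined_down:
  assumes "joined x k" "0 < k" shows "joined x (k - 1)"
proof -
  obtain T where T: "T \<in> D" "cell x k \<in> T" "cell (Suc x) k \<in> T" using assms(1) unfolding joined_def by blast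
  have "\<not> (\<forall>(a, b)\<in>T. b - 1 \<le> ht lam (nat a))"
    using T(2) assms(2) by (intro notI) (drule bspec[OF _ T(2)], simp add: cell_def)
  then obtain T' where T': "T' \<in> D" "(\<lambda>(a, b). (a, b - 2)) ` T \<subseteq> T'" using cover_D[OF T(1)] by blast
  have "cell x (k - 1) \<in> T'" "cell (Suc x) (k - 1) \<in> T'"
    using T'(2) imageI[OF T(2), of "\<lambda>(a, b). (a, b - 2)"]
      imageI[OF T(3), of "\<lambda>(a, b). (a, b - 2)"] unfolding cell_down by blast+
  then show ?thesis using T'(1) unfolding joined_def by blast
qed

lemma joined_iff: "joined x k \<longleftrightarrow> 0 \<le> k \<and> k < label_of x"
proof -
  have "{k. joined x k} \<subseteq> {0..<height_of x}" using joined_bounds by auto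
  from mem_initial_segment_iff[OF this, of k] joined_down show ?thesis by (simp add: label_of_def)
qed

lemma tile_D_eq_tile:
  assumes T: "T \<in> D" and x: "cell x k \<in> T"
  shows "T = tile label_of k x"
proof -
  obtain l c d where cd: "0 \<le> l" "c \<le> d" "d \<le> 2 * n" "T = (\<lambda>y. cell y l) ` {c..d}"
    "ht lam c = ht lam d" "\<forall>y\<in>{c..d}. ht lam c \<le> ht lam y"
    by (rule tile_D_shape[OF T])
  have xl: "l = k" "c \<le> x" "x \<le> d" using x cd(4) by auto
  have inner: "k < label_of z" if "c \<le> z" "z < d" for z
  proof -
    have "cell z k \<in> T" "cell (Suc z) k \<in> T" unfolding cd(4) xl(1) using that by auto
    then have "joined z k" unfolding joined_def using T by blast
    then show ?thesis using joined_iff by simp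
  qed
  \<comment> \<open>Boxes joined in some tile lie both in \<open>T\<close> or both outside, by
    disjointness; hence a linked run cannot leave \<open>T\<close> at either end.\<close>
  have stop: "z \<in> {c..d} \<longleftrightarrow> Suc z \<in> {c..d}" if "k < label_of z" for z
  proof -
    have "joined z k" using joined_iff that xl(1) cd(1) by simp
    then obtain T' where T': "T' \<in> D" "cell z k \<in> T'" "cell (Suc z) k \<in> T'" unfolding joined_def by blast
    have "cell z k \<in> T \<longleftrightarrow> cell (Suc z) k \<in> T" using T' T disjoint_D by blast
    then show ?thesis unfolding cd(4) xl(1) by auto
  qed
  have run: "linked label_of k x y \<longleftrightarrow> y \<in> {c..d}" for y
  proof
    assume link: "linked label_of k x y"
    show "y \<in> {c..d}"
    proof (rule ccontr)
      assume "y \<notin> {c..d}"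
      then consider "d < y" | "y < c" by force
      then show False
      proof cases
        case 1
        then have "k < label_of d" using link xl(3) linked_le[of x y] by auto
        then show False using stop[of d] cd(2) by auto
      next
        case 2
        then have "y \<le> x" "y \<le> c - 1" "c - 1 < x" using xl(2) by linarith+
        then have "k < label_of (c - 1)" using link linked_le[of y x label_of k] linked_sym by blast
        then show False using stop[of "c - 1"] cd(2) 2 by auto
      qed
    qed
  next
    assume "y \<in> {c..d}"
    then show "linked label_of k x y" using inner xl unfolding linked_def by auto
  qed
  have "{y. y \<le> 2 * n \<and> linked label_of k x y} = {c..d}" unfolding run using cd(3) by auto
  then show ?thesis unfolding tile_def cd(4) xl(1) by simp
qed

lemma D_eq_tiles: "D = tiles height_of label_of"
proof (intro set_eqI iffI)
  fix T assume T: "T \<in> D"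
  obtain l c d where cd: "0 \<le> l" "c \<le> d" "d \<le> 2 * n" "T = (\<lambda>y. cell y l) ` {c..d}"
    "ht lam c = ht lam d" "\<forall>y\<in>{c..d}. ht lam c \<le> ht lam y"
    by (rule tile_D_shape[OF T])
  have "cell c l \<in> T" using cd by auto
  then show "T \<in> tiles height_of label_of"
    using tile_D_eq_tile[OF T] cell_D[OF _ T] unfolding tiles_def by blast
next
  fix T assume "T \<in> tiles height_of label_of"
  then obtain x k where x: "T = tile label_of k x" "x \<le> 2 * n" "0 \<le> k" "k < height_of x"
    by (auto simp: tiles_def)
  then have "cell x k \<in> \<Union>D" unfolding Union_D_cells by blast
  then obtain T' where "T' \<in> D" "cell x k \<in> T'" by blast
  then show "T \<in> D" using tile_D_eq_tile x(1) by blast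
qed

lemma valid_tiling: "valid height_of label_of"
proof -
  have zero: "height_of 0 = 0" "height_of (2 * n) = 0"
    using dyck_ht_end[OF dyck] dyck_ht_end[OF dyck_mu] by (simp_all add: height_of_def)
  have bounds: "0 \<le> label_of x" "label_of x \<le> height_of x" "label_of x \<le> height_of (Suc x)" if "x < 2 * n" for x
    using joined_iff[of x "height_of x"] joined_iff[of x "height_of (Suc x)"]
      joined_bounds[of x "height_of x"] joined_bounds[of x "height_of (Suc x)"]
      height_of_nonneg[of x] height_of_nonneg[of "Suc x"] that
    by (force simp: label_of_def)+
  have step: "if lam ! x then height_of (Suc x) \<le> height_of x \<and> height_of x \<le> height_of (Suc x) + 1
         else height_of x \<le> height_of (Suc x) \<and> height_of (Suc x) \<le> height_of x + 1" if "x < 2 * n" for x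
    using ht_mu[of x] ht_mu[of "Suc x"] ht_Suc[of x lam] ht_Suc[of x mu] len dyck_length[OF dyck_mu] that
    by (auto split: if_splits)
  \<comment> \<open>A tile across the first or last step of a chord covers a position at the height
    where the chord opens, so both ends of its piece of \<open>lam\<close> are at most that high.
    Strictly inside the chord the path is higher, so the tile spans the whole chord.\<close>
  have chord: "label_of i \<le> label_of z" "label_of p \<le> label_of i"
    if ip: "(i, p) \<in> chords lam" and z: "i \<le> z" "z \<le> p" for i p z
  proof -
    note D = chords_D[OF ip, unfolded fst_conv snd_conv]
    have ht_end: "ht lam (Suc p) = ht lam i" using D(5) .
    have run: "\<exists>c d. c \<le> y \<and> Suc y \<le> d \<and> ht lam c \<le> ht lam i \<and> ht lam d \<le> ht lam i \<and> (\<forall>z. c \<le> z \<and> z < d \<longrightarrow> joined z k)"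
      if y: "y = i \<or> y = p" and k: "joined y k" for y k
    proof -
      obtain T where T: "T \<in> D" "cell y k \<in> T" "cell (Suc y) k \<in> T" using k unfolding joined_def by blast
      obtain l c d where cd: "0 \<le> l" "c \<le> d" "d \<le> 2 * n" "T = (\<lambda>y. cell y l) ` {c..d}"
        "ht lam c = ht lam d" "\<forall>y\<in>{c..d}. ht lam c \<le> ht lam y"
        by (rule tile_D_shape[OF T(1)])
      have yl: "l = k" "c \<le> y" "Suc y \<le> d" using T cd(4) by auto
      have "ht lam c \<le> ht lam y" "ht lam c \<le> ht lam (Suc y)" using cd(6) yl by auto
      then have "ht lam c \<le> ht lam i" using y ht_end by auto
      moreover have "joined z k" if "c \<le> z" "z < d" for z
      proof -
        have "cell z k \<in> T" "cell (Suc z) k \<in> T" unfolding cd(4) yl(1) using that by auto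
        then show ?thesis unfolding joined_def using T(1) by blast
      qed
      ultimately have "c \<le> y \<and> Suc y \<le> d \<and> ht lam c \<le> ht lam i \<and> ht lam d \<le> ht lam i \<and>
          (\<forall>z. c \<le> z \<and> z < d \<longrightarrow> joined z k)"
        using yl cd(5) by auto
      then show ?thesis by blast
    qed
    have "joined z k" if k: "joined i k" for k
    proof -
      obtain c d where cd: "c \<le> i" "Suc i \<le> d" "ht lam d \<le> ht lam i" "\<And>z. c \<le> z \<Longrightarrow> z < d \<Longrightarrow> joined z k"
        using run[OF _ k] by blast
      have "\<not> d \<le> p" using D(6)[of d] cd(2,3) by auto
      then show ?thesis using cd z by auto
    qed
    then show "label_of i \<le> label_of z"
      using joined_iff[of i "label_of z"] joined_iff[of z "label_of z"] by (force simp: label_of_def)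
    have "joined i k" if k: "joined p k" for k
    proof -
      obtain c d where cd: "c \<le> p" "Suc p \<le> d" "ht lam c \<le> ht lam i" "\<And>z. c \<le> z \<Longrightarrow> z < d \<Longrightarrow> joined z k"
        using run[OF _ k] by blast
      have "\<not> i < c" using D(6)[of c] cd(1,3) by auto
      then show ?thesis using cd D(1) by auto
    qed
    then show "label_of p \<le> label_of i"
      using joined_iff[of p "label_of i"] joined_iff[of i "label_of i"] by (force simp: label_of_def)
  qed
  have "label_of (fst c) = label_of (snd c) \<and> (\<forall>x. fst c < x \<and> x < snd c \<longrightarrow> label_of (fst c) \<le> label_of x)"
    if c: "c \<in> chords lam" for c
  proof -
    have c': "(fst c, snd c) \<in> chords lam" "fst c \<le> snd c" using c chords_D(1)[OF c] by simp_all
    show ?thesis using chord(1)[OF c'(1)] chord(2)[OF c'(1) order_refl c'(2)] c'(2)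
      by (auto intro: antisym)
  qed
  then show ?thesis unfolding valid_def using zero bounds step by blast
qed

end

section \<open>The bijection and the resulting generating function\<close>

lemma bij_betw_configs_tilings:
  "bij_betw (\<lambda>xs. (upper (col_height 0 xs), tiles (col_height 0 xs) (\<lambda>x. fst (xs ! x))))
     (configs lam 0 0 0) (tilings_star lam n)"
  unfolding bij_betw_def
proof (intro conjI inj_onI set_eqI iffI)
  fix xs ys
  let ?m = "col_height 0" and ?j = "\<lambda>xs x. fst (xs ! x)"
  assume "xs \<in> configs lam 0 0 0" "ys \<in> configs lam 0 0 0"
    and eq: "(upper (?m xs), tiles (?m xs) (?j xs)) = (upper (?m ys), tiles (?m ys) (?j ys))"
  then have l: "length xs = 2 * n" "length ys = 2 * n" and val: "valid (?m xs) (?j xs)" "valid (?m ys) (?j ys)"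
    by (auto simp: configs_iff_valid)
  have m: "?m xs x = ?m ys x" if "x \<le> 2 * n" for x
    using ht_upper[OF val(1) that] ht_upper[OF val(2) that] eq by simp
  have j: "?j xs x = ?j ys x" if "x < 2 * n" for x
  proof -
    \<comment> \<open>Each label is the least nonnegative level outside its own segment; testing the
      equivalence at both labels forces them to agree.\<close>
    have "0 \<le> k \<and> k < ?j xs x \<longleftrightarrow> 0 \<le> k \<and> k < ?j ys x" for k
      using tiles_joined_iff[OF val(1) that, of k] tiles_joined_iff[OF val(2) that, of k] eq by simp
    from this[of "?j xs x"] this[of "?j ys x"] show ?thesis
      using valid_j(1)[OF val(1) that] valid_j(1)[OF val(2) that] by auto
  qed
  show "xs = ys"
  proof (rule nth_equalityI)
    fix x assume "x < length xs"
    then show "xs ! x = ys ! x" using m[of "Suc x"] j[of x] l by (simp add: col_height_def prod_eq_iff)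
  qed (simp add: l)
next
  fix p assume "p \<in> (\<lambda>xs. (upper (col_height 0 xs), tiles (col_height 0 xs) (\<lambda>x. fst (xs ! x)))) ` configs lam 0 0 0"
  then show "p \<in> tilings_star lam n" using tiles_in_tilings_star configs_iff_valid by auto
next
  fix p assume p: "p \<in> tilings_star lam n"
  obtain mu D where pD: "p = (mu, D)" by (cases p)
  note t = p[unfolded pD]
  define m where "m = height_of mu"
  define j where "j = label_of D"
  define xs where "xs = map (\<lambda>x. (j x, m (Suc x))) [0..<2 * n]"
  have val: "valid m j" and D: "D = tiles m j"
    unfolding m_def j_def by (rule valid_tiling[OF t], rule D_eq_tiles[OF t])
  have agree: "m x = col_height 0 xs x" if "x \<le> 2 * n" for x
    using that val by (cases x) (auto simp: col_height_def xs_def valid_def)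
  have agree': "j x = fst (xs ! x)" if "x < 2 * n" for x
    using that by (simp add: xs_def)
  have val': "valid (col_height 0 xs) (\<lambda>x. fst (xs ! x))"
    by (rule valid_cong[OF agree agree' val])
  have "xs \<in> configs lam 0 0 0" using val' by (simp add: configs_iff_valid xs_def)
  moreover have "D = tiles (col_height 0 xs) (\<lambda>x. fst (xs ! x))"
    unfolding D by (rule tiles_cong[OF agree agree'])
  moreover have "mu = upper (col_height 0 xs)"
  proof (rule path_eqI)
    show "length mu = length (upper (col_height 0 xs))"
      using dyck_length[OF dyck_mu[OF t]] by (simp add: upper_def)
    fix x assume "x \<le> length mu"
    then have x: "x \<le> 2 * n" using dyck_length[OF dyck_mu[OF t]] by simp
    show "ht mu x = ht (upper (col_height 0 xs)) x"
      using ht_mu[OF t x] ht_upper[OF val' x] agree[OF x] by (simp add: m_def)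
  qed
  ultimately show "p \<in> (\<lambda>xs. (upper (col_height 0 xs), tiles (col_height 0 xs) (\<lambda>x. fst (xs ! x)))) ` configs lam 0 0 0"
    unfolding pD by blast
qed

lemma tilings_gf: "(\<Sum>(mu, D)\<in>tilings_star lam n. monom (1::int) (art D)) = config_gf lam 0 0 0"
proof -
  have "(\<Sum>(mu, D)\<in>tilings_star lam n. monom (1::int) (art D))
    = (\<Sum>xs\<in>configs lam 0 0 0. monom 1 (art (tiles (col_height 0 xs) (\<lambda>x. fst (xs ! x)))))"
    by (subst sum.reindex_bij_betw[OF bij_betw_configs_tilings, symmetric]) simp
  also have "\<dots> = config_gf lam 0 0 0"
    unfolding config_gf_def
  proof (intro sum.cong refl)
    fix xs assume "xs \<in> configs lam 0 0 0"
    from art_tiles[OF this] show "monom 1 (art (tiles (col_height 0 xs) (\<lambda>x. fst (xs ! x)))) = qp (weight lam xs)"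
      by (simp add: monom_eq_qv_power flip: qp_of_nat)
  qed
  finally show ?thesis .
qed

end

theorem mainTheorem2:
  fixes lam :: "bool list" and n :: nat
  assumes "dyck lam n"
  shows "(\<Sum>(mu, D)\<in>tilings_star lam n. monom (1::int) (art D)) =
         (\<Prod>v\<in>{v\<in>vertices lam. 2 \<le> card (children lam v)}.
             q_multinom (M_vert lam v) (N_sub lam) (children lam v))"
proof -
  interpret dyck_path lam n by unfold_locales (rule assms)
  \<comment> \<open>Both paths have height 0 at their ends, so only the corner entry of the kernel
    enters.\<close>
  have "config_gf lam 0 0 0 = tree_gf lam"
    using config_gf_eq[OF assms, of 0 0 0] by simp
  then show ?thesis using tilings_gf tree_gf_eq_branching[of lam] by simp
qed

end
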